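(* Let $r \geq 2$ be an integer, let $0 < \alpha \leq (r-1)^2/r^2$, and let $A \in M_n(\mathbb{C})$ be a PSD contraction all of whose diagonal entries are at most $\alpha$. Then there are diagonal projections $Q_1, \ldots, Q_r \in M_n(\mathbb{C})$ such that \[\sum_{i=1}^r Q_i = I \qquad \text{and} \qquad \|Q_iAQ_i\| \leq \left(\sqrt{\frac{1}{r}-\frac{\alpha}{r-1}}+ \sqrt{\alpha}\right)^2 \quad \text{for all } i \in \{1,\ldots,r\}.\]
   Context: A PSD contraction is a Hermitian matrix with all eigenvalues in $[0,1]$. A diagonal projection is a diagonal matrix $Q$ with $Q = Q^* = Q^2$ (i.e. all diagonal entries in $\{0,1\}$; $Q=0$ is allowed). $\|\cdot\|$ is the operator norm. *)

theory Defs
  imports "HOL-Analysis.Analysis"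
begin

definition conj_transpose :: "complex^'n^'m \<Rightarrow> complex^'m^'n" where
  "conj_transpose A = (\<chi> i j. cnj (A $ j $ i))"

definition hermitian_matrix :: "complex^'n^'n \<Rightarrow> bool" where
  "hermitian_matrix A \<longleftrightarrow> conj_transpose A = A"

definition eigenvalue_of :: "complex^'n^'n \<Rightarrow> complex \<Rightarrow> bool" where
  "eigenvalue_of A c \<longleftrightarrow> (\<exists>v. v \<noteq> 0 \<and> A *v v = c *s v)"

definition psd_contraction :: "complex^'n^'n \<Rightarrow> bool" where
  "psd_contraction A \<longleftrightarrow>
     hermitian_matrix A \<and> (\<forall>c. eigenvalue_of A c \<longrightarrow> c \<in> complex_of_real ` {0..1})"

definition diagonal_projection :: "complex^'n^'n \<Rightarrow> bool" where
  "diagonal_projection Q \<longleftrightarrow>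
     (\<forall>i j. i \<noteq> j \<longrightarrow> Q $ i $ j = 0) \<and> conj_transpose Q = Q \<and> Q ** Q = Q"

text \<open>The norm of the library on \<^typ>\<open>complex^'n\<close> is the Euclidean one, so this is the
  \<open>\<ell>\<^sup>2\<close> operator norm.\<close>

definition operator_norm :: "complex^'n^'m \<Rightarrow> real" where
  "operator_norm A = onorm (\<lambda>v. A *v v)"

end

theory Submission
  imports Defs "HOL-Computational_Algebra.Fundamental_Theorem_Algebra"
begin

text \<open>Take \<open>r\<close> variables \<open>z\<^sub>i\<^sub>j\<close> for each index \<open>i\<close>. For a partition \<open>S\<^sub>1, \<dots>, S\<^sub>r\<close> of the indices the product of
  the characteristic polynomials of the blocks is a partial derivative of
  \<open>\<Prod>\<^sub>j det (diag z\<^sub>j - A)\<close>, which keeps for each \<open>i\<close> exactly one variable \<open>z\<^sub>i\<^sub>j\<close>. The sum over all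
  partitions arises by treating the indices one at a time, and all sums on the way are real stable.
  By interlacing, the largest root for some partition is at most the largest root of the total sum.
  The latter is bounded by a barrier argument: one starts above the roots at a point \<open>b > 1\<close> where
  the logarithmic derivatives are controlled by the diagonal of \<open>1 / (b - A)\<close>, and moves down by a
  fixed \<open>\<delta>\<close> in the variables of an index when that index is treated, which does not increase the
  logarithmic derivatives in the remaining ones.\<close>

text \<open>The size of \<delta> rests on the term \<open>1 / b\<close>. The diagonal of
  \<open>A\<close> is nonnegative, so along a block no root lies further than \<open>b\<close> below
  the current point. Each reciprocal distance to a root is therefore at least \<open>1 / b\<close>,
  and any r - 1 of them share only \<open>\<phi> - 1 / b\<close>; bounding them by \<phi> alone
  would give a smaller shift. All comparisons come from one fact: the ratio of a function to its
  partial derivative in \<open>v\<close> has imaginary part at least that of the variable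
  \<open>v\<close>. It yields the stability of the sums, the monotonicity of the ratios at real
  points, and the interlacing. "Above the roots" means positivity on a whole orthant, since
  variables of different indices move independently. At \<alpha> = (r - 1)^2 / r^2 the optimal start
  \<open>b\<close> drops to 1, where the estimate of the resolvent degenerates. The claimed bound is
  then 1 and the trivial partition attains it, so this case is split off.\<close>

section \<open>Interlacing real polynomials\<close>

definition cpoly :: "real poly \<Rightarrow> complex \<Rightarrow> complex" where
  "cpoly p u = poly (map_poly complex_of_real p) u"

lemma cpoly_pCons [simp]: "cpoly (pCons a p) u = of_real a + u * cpoly p u"
  by (simp add: cpoly_def map_poly_pCons)

lemma cpoly_0 [simp]: "cpoly 0 u = 0"
  by (simp add: cpoly_def)

lemma cpoly_add: "cpoly (p + q) u = cpoly p u + cpoly q u"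
proof -
  have "map_poly complex_of_real (p + q) = map_poly complex_of_real p + map_poly complex_of_real q"
    by (rule poly_eqI) (simp add: coeff_map_poly)
  then show ?thesis by (simp add: cpoly_def)
qed

lemma cpoly_smult: "cpoly (smult c p) u = of_real c * cpoly p u"
  by (induction p) (simp_all add: algebra_simps)

lemma cpoly_mult: "cpoly (p * q) u = cpoly p u * cpoly q u"
  by (induction p) (simp_all add: algebra_simps cpoly_add cpoly_smult)

lemma cpoly_1 [simp]: "cpoly 1 u = 1"
  by (simp add: cpoly_def)

lemma cpoly_power: "cpoly (p ^ n) u = cpoly p u ^ n"
  by (induction n) (simp_all add: cpoly_mult)

lemma cpoly_of_real: "cpoly p (of_real x) = of_real (poly p x)"
  by (induction p) simp_all

lemma continuous_on_cpoly: "continuous_on S (cpoly p)"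
  unfolding cpoly_def by (intro continuous_intros)

text \<open>Approach the root \<open>-d\<close> along the ray of angle \<open>\<theta>\<close>.\<close>

lemma interlacing_at_root:
  fixes g h :: "real poly"
  assumes Im: "\<And>u. Im u > 0 \<Longrightarrow> Im (cpoly ([:d,1:] ^ m * g) u * cnj (cpoly h u)) \<ge> 0"
    and \<theta>: "0 < \<theta>" "\<theta> < pi"
  shows "sin (real m * \<theta>) * (poly g (-d) * poly h (-d)) \<ge> 0"
proof -
  define F where "F = (\<lambda>e::real. Im (cis (real m * \<theta>) * cpoly g (of_real (-d) + of_real e * cis \<theta>)
      * cnj (cpoly h (of_real (-d) + of_real e * cis \<theta>))))"
  have "continuous_on UNIV F"
    unfolding F_def
    by (intro continuous_intros continuous_on_compose2[OF continuous_on_cpoly[of UNIV]]) auto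
  hence "(F \<longlongrightarrow> F 0) (at_right 0)"
    by (metis UNIV_I continuous_on_def open_UNIV tendsto_within_subset subset_UNIV)
  moreover have "eventually (\<lambda>e. F e \<ge> 0) (at_right 0)"
  proof (rule eventually_at_right_less[THEN eventually_mono])
    fix e :: real assume e: "0 < e"
    define u where "u = of_real (-d) + of_real e * cis \<theta>"
    have "sin \<theta> > 0" using \<theta> by (simp add: sin_gt_zero)
    hence "Im u > 0" using e by (simp add: u_def)
    from Im[OF this] have "0 \<le> Im ((of_real e * cis \<theta>) ^ m * cpoly g u * cnj (cpoly h u))"
      by (simp add: cpoly_mult cpoly_power u_def)
    also have "(of_real e * cis \<theta>) ^ m = of_real (e ^ m) * cis (real m * \<theta>)"
      by (simp add: power_mult_distrib Complex.DeMoivre)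
    also have "Im (of_real (e ^ m) * cis (real m * \<theta>) * cpoly g u * cnj (cpoly h u)) = e ^ m * F e"
      unfolding F_def u_def[symmetric]
      by (simp only: mult.assoc Im_complex_of_real Re_complex_of_real times_complex.sel mult_zero_left add_0_right)
    finally show "F e \<ge> 0" using zero_less_power[OF e, of m] by (auto simp: zero_le_mult_iff)
  qed
  ultimately have "F 0 \<ge> 0"
    by (rule tendsto_lowerbound) simp
  moreover have "F 0 = sin (real m * \<theta>) * (poly g (-d) * poly h (-d))"
    unfolding F_def using cpoly_of_real[of g "-d"] cpoly_of_real[of h "-d"] by simp
  ultimately show ?thesis by simp
qed

text \<open>The roots are the numbers \<open>-d\<close>. With the current point as origin, the
  entries of \<open>ds\<close> are then the positive distances down to the roots.\<close>

abbreviation root_poly :: "real list \<Rightarrow> real poly" where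
  "root_poly ds \<equiv> (\<Prod>d\<leftarrow>ds. [:d, 1:])"

lemma root_poly_nz [simp]: "root_poly ds \<noteq> 0"
  by (induction ds) (simp_all del: mult_pCons_left)

lemma degree_root_poly [simp]: "degree (root_poly ds) = length ds"
proof (induction ds)
  case (Cons d ds)
  then show ?case by (simp add: degree_mult_eq del: mult_pCons_left)
qed auto

lemma lead_coeff_root_poly: "coeff (root_poly ds) (length ds) = 1"
proof (induction ds)
  case (Cons d ds)
  have "coeff (root_poly ds) (Suc (length ds)) = 0"
    by (rule coeff_eq_0) simp
  with Cons show ?case by simp
qed auto

text \<open>Reading coefficient n of \<open>pCons 0 p\<close> gives coefficient n - 1 of
  \<open>p\<close>, and 0 when n = 0. This avoids truncated subtraction for the empty list.\<close>

lemma subleading_coeff_root_poly: "coeff (pCons 0 (root_poly ds)) (length ds) = sum_list ds"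
proof (induction ds)
  case (Cons d ds)
  show ?case
  proof (cases ds)
    case Nil then show ?thesis by simp
  next
    case (Cons d' ds')
    have "coeff (root_poly (d # ds)) (length ds) = d * coeff (root_poly ds) (length ds) + coeff (root_poly ds) (length ds')"
      using Cons by (simp del: prod_list.Cons list.map add: prod_list.Cons[of "[:d,1:]"] list.map(2)[of _ d])
    then show ?thesis using Cons.IH lead_coeff_root_poly[of ds] Cons
      by simp
  qed
qed auto

lemma poly_root_poly_0: "poly (root_poly ds) 0 = prod_list ds"
  by (induction ds) auto

lemma poly_root_poly_eq_0_iff: "poly (root_poly ds) x = 0 \<longleftrightarrow> -x \<in> set ds"
proof (induction ds)
  case (Cons d ds)
  have "poly (root_poly (d # ds)) x = (d + x) * poly (root_poly ds) x"
    by (simp add: algebra_simps)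
  then show ?case using Cons by (auto simp: add_eq_0_iff2)
qed auto

lemma root_poly_remove1: "d \<in> set ds \<Longrightarrow> root_poly ds = [:d,1:] * root_poly (remove1 d ds)"
  by (induction ds) (auto simp: algebra_simps simp del: mult_pCons_left mult_pCons_right)

lemma sum_list_remove1: "d \<in> set ds \<Longrightarrow> sum_list ds = d + sum_list (remove1 d (ds :: real list))"
  by (induction ds) auto

lemma prod_list_remove1: "d \<in> set ds \<Longrightarrow> prod_list ds = d * prod_list (remove1 d (ds :: real list))"
  by (induction ds) auto

text \<open>After cancelling common roots, the hypothesis gives partial fractions
  \<open>h / q = \<kappa> + (\<Sum>d. \<mu> d / (u + d))\<close> with \<open>\<mu> d \<ge> 0\<close>, and the bound holds for each summand.\<close>

lemma interlacing_coeff_bound: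
  fixes h :: "real poly" and ds :: "real list"
  assumes "\<And>d. d \<in> set ds \<Longrightarrow> 0 < d \<and> d \<le> M"
    and "degree h \<le> length ds"
    and "\<And>u. Im u > 0 \<Longrightarrow> Im (cpoly (root_poly ds) u * cnj (cpoly h u)) \<ge> 0"
  shows "(coeff (pCons 0 h) (length ds) + (M - sum_list ds) * coeff h (length ds)) * prod_list ds
           \<le> M * poly h 0"
  using assms
proof (induction "length ds" arbitrary: ds h rule: less_induct)
  case (less ds h)
  note ds = less.prems(1) and deg = less.prems(2) and Im = less.prems(3)
  let ?n = "length ds"
  show ?case
  proof (cases "\<exists>d\<in>set ds. poly h (-d) = 0")
    case True
    then obtain d where d: "d \<in> set ds" "poly h (-d) = 0" by blast
    then obtain h1 where h1: "h = [:d,1:] * h1"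
      using poly_eq_0_iff_dvd[of h "-d"] by auto
    define ds1 where "ds1 = remove1 d ds"
    have n: "?n = Suc (length ds1)"
      using d(1) by (auto simp: ds1_def length_remove1 Suc_pred[OF length_pos_if_in_set])
    have deg1: "degree h1 \<le> length ds1"
    proof (cases "h1 = 0")
      case False
      then have "degree h = 1 + degree h1" unfolding h1 by (subst degree_mult_eq) auto
      with deg n show ?thesis by simp
    qed auto
    have "(coeff (pCons 0 h1) (length ds1) + (M - sum_list ds1) * coeff h1 (length ds1)) * prod_list ds1
           \<le> M * poly h1 0"
    proof (rule less.hyps)
      show "0 < x \<and> x \<le> M" if "x \<in> set ds1" for x
        using ds that set_remove1_subset[of d ds] by (auto simp: ds1_def)
      fix u :: complex assume u: "Im u > 0"
      \<comment> \<open>A common factor u + d contributes only |u + d|^2 > 0 to the product, so the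
        sign hypothesis passes to the quotients.\<close>
      have "cpoly (root_poly ds) u * cnj (cpoly h u)
          = of_real ((cmod (of_real d + u))\<^sup>2) * (cpoly (root_poly ds1) u * cnj (cpoly h1 u))"
        unfolding root_poly_remove1[OF d(1)] h1 cpoly_mult ds1_def complex_norm_square by (simp add: algebra_simps)
      hence "Im (cpoly (root_poly ds) u * cnj (cpoly h u))
          = (cmod (of_real d + u))\<^sup>2 * Im (cpoly (root_poly ds1) u * cnj (cpoly h1 u))"
        by (simp only: times_complex.sel Im_complex_of_real Re_complex_of_real mult_zero_left add_0_right)
      moreover have "of_real d + u \<noteq> 0" using u by (auto simp: complex_eq_iff)
      ultimately show "Im (cpoly (root_poly ds1) u * cnj (cpoly h1 u)) \<ge> 0"
        using Im[OF u] by (simp add: zero_le_mult_iff)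
    qed (use n deg1 in auto)
    moreover have "coeff h1 (Suc (length ds1)) = 0" using deg1 by (intro coeff_eq_0) simp
    ultimately have "d * ((coeff (pCons 0 h1) (length ds1) + (M - sum_list ds1) * coeff h1 (length ds1)) * prod_list ds1)
           \<le> d * (M * poly h1 0)" and "coeff h1 (Suc (length ds1)) = 0"
      using ds[OF d(1)] by (auto intro!: mult_left_mono)
    then show ?thesis
      unfolding n sum_list_remove1[OF d(1)] prod_list_remove1[OF d(1)] ds1_def[symmetric]
      by (simp add: h1 algebra_simps)
  next
    case False
    \<comment> \<open>Near a root of order m the sign of the hypothesis is that of sin (m \<theta>)
      times a nonzero constant. For m \<ge> 2 the angles \<pi> / (2 m) and 3 \<pi> / (2 m) give
      opposite signs.\<close>
    have main: "order (-d) (root_poly ds) = 1" if d: "d \<in> set ds" for d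
    proof -
      define m where "m = order (-d) (root_poly ds)"
      obtain g where g: "root_poly ds = [:-(-d),1:] ^ m * g" "\<not> [:-(-d),1:] dvd g"
        unfolding m_def using order_decomp[OF root_poly_nz] by blast
      have gnz: "poly g (-d) \<noteq> 0" using g(2) poly_eq_0_iff_dvd[of g "-d"] by simp
      have S: "sin (real m * \<theta>) * (poly g (-d) * poly h (-d)) \<ge> 0" if "0 < \<theta>" "\<theta> < pi" for \<theta>
        using interlacing_at_root[of d m g h \<theta>] Im g(1) that by simp
      have "m \<noteq> 0" using d poly_root_poly_eq_0_iff[of ds "-d"] order_root[of "root_poly ds" "-d"] by (auto simp: m_def)
      moreover have "\<not> m \<ge> 2"
      proof
        assume m: "m \<ge> 2"
        have eq: "real m * (pi / (2 * m)) = pi / 2" "real m * (3 * pi / (2 * m)) = 3 * pi / 2"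
          using m by (auto simp: field_simps)
        have "sin (pi / 2 + pi) = -1"
          unfolding sin_periodic_pi by simp
        then have sin: "sin (3 * pi / 2) = -1"
          by (simp add: field_simps)
        have "0 < pi / (2 * m)" "pi / (2 * m) < pi" "0 < 3 * pi / (2 * m)" "3 * pi / (2 * m) < pi"
          using m by (auto simp: field_simps)
        then have "sin (pi / 2) * (poly g (-d) * poly h (-d)) \<ge> 0"
            "sin (3 * pi / 2) * (poly g (-d) * poly h (-d)) \<ge> 0"
          using S[of "pi / (2 * m)"] S[of "3 * pi / (2 * m)"] unfolding eq by simp_all
        then have "poly g (-d) * poly h (-d) = 0" by (simp add: sin)
        then show False using gnz False d by simp
      qed
      ultimately show ?thesis by (simp add: m_def)
    qed
    have "distinct ds"
    proof (rule ccontr)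
      assume "\<not> distinct ds"
      then obtain xs ys zs d where "ds = xs @ [d] @ ys @ [d] @ zs"
        using not_distinct_decomp by blast
      then have "d \<in> set ds" "[:-(-d),1:] ^ 2 dvd root_poly ds"
        by (auto simp: power2_eq_square mult.assoc mult.left_commute intro!: dvdI simp del: mult_pCons_left mult_pCons_right)
      then show False using main[of d] order_divides[of "-d" 2 "root_poly ds"] by simp
    qed
    define Q where "Q d = root_poly (remove1 d ds)" for d
    define \<mu> where "\<mu> d = poly h (-d) / poly (Q d) (-d)" for d
    have Qnz: "poly (Q d) (-d) \<noteq> 0" if "d \<in> set ds" for d
      using \<open>distinct ds\<close> that by (simp add: Q_def poly_root_poly_eq_0_iff)
    have \<mu>: "\<mu> d \<ge> 0" if d: "d \<in> set ds" for d
    proof -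
      have "sin (real 1 * (pi/2)) * (poly (Q d) (-d) * poly h (-d)) \<ge> 0"
        using interlacing_at_root[of d 1 "Q d" h "pi/2"] Im root_poly_remove1[OF d] by (simp add: Q_def)
      then show ?thesis by (auto simp: \<mu>_def zero_le_divide_iff zero_le_mult_iff)
    qed
    define \<kappa> where "\<kappa> = coeff h ?n"
    show ?thesis
    proof (cases "ds = []")
      case True
      then show ?thesis using deg by (auto elim!: degree_eq_zeroE)
    next
      case ne: False
      have lr: "length (remove1 d ds) = ?n - 1" if "d \<in> set ds" for d
        using that by (simp add: length_remove1)
      have "h - smult \<kappa> (root_poly ds) = (\<Sum>d\<in>set ds. smult (\<mu> d) (Q d))"
      proof (rule poly_eqI_degree[of "uminus ` set ds"])
        have c: "card (uminus ` set ds) = ?n" using \<open>distinct ds\<close>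
          by (simp add: card_image distinct_card)
        show "degree (h - smult \<kappa> (root_poly ds)) < card (uminus ` set ds)"
        proof -
          have "degree (h - smult \<kappa> (root_poly ds)) \<le> ?n"
            using deg by (intro degree_diff_le order_trans[OF degree_smult_le]) auto
          moreover have "coeff (h - smult \<kappa> (root_poly ds)) ?n = 0"
            by (simp add: \<kappa>_def lead_coeff_root_poly)
          ultimately have "degree (h - smult \<kappa> (root_poly ds)) < ?n"
            using ne by (metis degree_0 length_greater_0_conv le_neq_implies_less leading_coeff_0_iff)
          then show ?thesis using c by simp
        qed
        have "degree (\<Sum>d\<in>set ds. smult (\<mu> d) (Q d)) \<le> ?n - 1"
          by (intro degree_sum_le order_trans[OF degree_smult_le]) (auto simp: Q_def lr)
        moreover have "?n > 0" using ne by simp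
        ultimately show "degree (\<Sum>d\<in>set ds. smult (\<mu> d) (Q d)) < card (uminus ` set ds)"
          unfolding c by linarith
        fix x assume "x \<in> uminus ` set ds"
        then obtain d where d: "d \<in> set ds" "x = -d" by auto
        have "poly (\<Sum>d\<in>set ds. smult (\<mu> d) (Q d)) x = (\<Sum>e\<in>set ds. \<mu> e * poly (Q e) (-d))"
          by (simp add: poly_sum d)
        also have "\<dots> = (\<Sum>e\<in>{d}. \<mu> e * poly (Q e) (-d))"
        proof (rule sum.mono_neutral_right)
          show "\<forall>i\<in>set ds - {d}. \<mu> i * poly (Q i) (- d) = 0"
            using d by (auto simp: Q_def poly_root_poly_eq_0_iff in_set_remove1)
        qed (use d in auto)
        also have "\<dots> = poly h x" using Qnz[OF d(1)] d by (simp add: \<mu>_def)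
        finally show "poly (h - smult \<kappa> (root_poly ds)) x = poly (\<Sum>d\<in>set ds. smult (\<mu> d) (Q d)) x"
          using d poly_root_poly_eq_0_iff[of ds x] by simp
      qed
      then have h: "h = smult \<kappa> (root_poly ds) + (\<Sum>d\<in>set ds. smult (\<mu> d) (Q d))"
        by (simp add: algebra_simps)
      have "coeff (pCons 0 h) ?n = coeff h (?n - 1)"
        using ne by (auto simp: coeff_pCons split: nat.splits)
      also have "\<dots> = \<kappa> * sum_list ds + (\<Sum>d\<in>set ds. \<mu> d)"
      proof -
        have "coeff (root_poly ds) (?n - 1) = sum_list ds"
          using subleading_coeff_root_poly[of ds] ne by (auto simp: coeff_pCons split: nat.splits)
        moreover have "coeff (Q d) (?n - 1) = 1" if "d \<in> set ds" for d
          using lead_coeff_root_poly[of "remove1 d ds"] lr[OF that] by (simp add: Q_def)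
        ultimately show ?thesis by (subst h) (simp add: coeff_sum)
      qed
      finally have A: "coeff (pCons 0 h) ?n = \<kappa> * sum_list ds + (\<Sum>d\<in>set ds. \<mu> d)" .
      have pQ: "poly (Q d) 0 = prod_list ds / d" if "d \<in> set ds" for d
        using ds[OF that] prod_list_remove1[OF that] by (simp add: Q_def poly_root_poly_0)
      have B: "poly h 0 = \<kappa> * prod_list ds + (\<Sum>d\<in>set ds. \<mu> d * (prod_list ds / d))"
        by (subst h) (simp add: poly_root_poly_0 poly_sum pQ)
      have P: "prod_list ds \<ge> 0" using ds by (intro prod_list_nonneg) (auto intro: less_imp_le)
      have "(\<Sum>d\<in>set ds. \<mu> d) * prod_list ds \<le> M * (\<Sum>d\<in>set ds. \<mu> d * (prod_list ds / d))"
        unfolding sum_distrib_left sum_distrib_right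
      proof (rule sum_mono)
        fix d assume d: "d \<in> set ds"
        have "1 \<le> M / d" using ds[OF d] by simp
        then have "(\<mu> d * prod_list ds) * 1 \<le> (\<mu> d * prod_list ds) * (M / d)"
          using \<mu>[OF d] P by (intro mult_left_mono) auto
        then show "\<mu> d * prod_list ds \<le> M * (\<mu> d * (prod_list ds / d))" by (simp add: mult_ac)
      qed
      then show ?thesis unfolding A B \<kappa>_def[symmetric] by (simp add: algebra_simps)
    qed
  qed
qed

text \<open>Positivity descends from infinity: to the right of the last point s0 with
  \<open>e s0 \<le> 0\<close> the ratio is at most its value C at s0 + 1, so f \<le> C e there. In
  the limit f(s0) \<le> C e(s0) \<le> 0, against \<open>f > 0\<close>.\<close>

lemma ray_positive:
  fixes f e :: "real \<Rightarrow> real"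
  assumes cont: "continuous_on {0..} f" "continuous_on {0..} e"
    and f: "\<And>s. s \<ge> 0 \<Longrightarrow> f s > 0"
    and ev: "eventually (\<lambda>s. e s > 0) at_top"
    and mono: "\<And>s s'. 0 \<le> s \<Longrightarrow> s \<le> s' \<Longrightarrow> (\<And>t. s \<le> t \<Longrightarrow> t \<le> s' \<Longrightarrow> e t > 0) \<Longrightarrow> f s / e s \<le> f s' / e s'"
  shows "e 0 > 0"
proof (rule ccontr)
  assume neg: "\<not> e 0 > 0"
  define Z where "Z = {s. 0 \<le> s \<and> e s \<le> 0}"
  obtain K where K: "\<And>s. s \<ge> K \<Longrightarrow> e s > 0" using ev by (auto simp: eventually_at_top_linorder)
  have "0 \<in> Z" using neg by (simp add: Z_def)
  moreover have bdd: "bdd_above Z"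
  proof (rule bdd_aboveI[of _ K])
    fix x assume "x \<in> Z"
    then show "x \<le> K" using K[of x] by (cases "x \<le> K") (auto simp: Z_def)
  qed
  moreover have "closed Z"
  proof -
    have "Z = {0..} \<inter> e -` {..0}" by (auto simp: Z_def)
    then show ?thesis using continuous_closed_preimage[OF cont(2)] by simp
  qed
  ultimately have S: "Sup Z \<in> Z" by (intro closed_contains_Sup) auto
  define s0 where "s0 = Sup Z"
  have s0: "0 \<le> s0" "e s0 \<le> 0" using S by (auto simp: Z_def s0_def)
  have gt: "e s > 0" if "s > s0" for s
  proof (rule ccontr)
    assume "\<not> e s > 0"
    then have "s \<in> Z" using that s0 by (simp add: Z_def)
    from cSup_upper[OF this bdd] that show False by (simp add: s0_def)
  qed
  define C where "C = f (s0 + 1) / e (s0 + 1)"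
  have "eventually (\<lambda>s. C * e s - f s \<ge> 0) (at_right s0)"
    unfolding eventually_at_right[OF less_add_one]
  proof (intro exI[of _ "s0 + 1"] conjI allI impI)
    fix s assume s: "s0 < s" "s < s0 + 1"
    then have "f s / e s \<le> C" unfolding C_def using s0 by (intro mono gt) auto
    then show "C * e s - f s \<ge> 0" using gt[OF s(1)] by (simp add: divide_le_eq)
  qed simp
  moreover have "((\<lambda>s. C * e s - f s) \<longlongrightarrow> C * e s0 - f s0) (at_right s0)"
  proof -
    have "(g \<longlongrightarrow> g s0) (at_right s0)" if "continuous_on {0..} g" for g :: "real \<Rightarrow> real"
      using that s0 by (auto simp: continuous_on_def intro: tendsto_within_subset)
    then show ?thesis using cont by (intro tendsto_intros)
  qed
  ultimately have "C * e s0 - f s0 \<ge> 0" by (intro tendsto_lowerbound) auto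
  moreover have "C > 0" using f[of "s0 + 1"] gt[of "s0 + 1"] s0 by (simp add: C_def)
  ultimately show False using f[OF s0(1)] s0(2)
    by (smt (verit) mult_nonneg_nonpos)
qed

lemma cpoly_sum: "cpoly (sum f A) u = (\<Sum>x\<in>A. cpoly (f x) u)"
  by (induction A rule: infinite_finite_induct) (simp_all add: cpoly_add)

lemma cpoly_monom: "cpoly (monom a n) u = of_real a * u ^ n"
  by (induction n) (simp_all add: monom_0 monom_Suc)

text \<open>Subtracting a real multiple of \<open>q\<close> from \<open>p\<close> leaves Im (p cnj
  q) unchanged. With \<kappa> the value of p / q at t and p - \<kappa> q = (x - t) g, the derivative
  of p / q at t is g(t) / q(t), whose sign follows by approaching t vertically.\<close>

lemma poly_ratio_mono:
  fixes p q :: "real poly"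
  assumes Im: "\<And>u. Im u > 0 \<Longrightarrow> Im (cpoly p u * cnj (cpoly q u)) \<ge> 0"
    and s: "s \<le> s'" and q: "\<And>t. s \<le> t \<Longrightarrow> t \<le> s' \<Longrightarrow> poly q t > 0"
  shows "poly p s / poly q s \<le> poly p s' / poly q s'"
proof (rule DERIV_nonneg_imp_nondecreasing[OF s])
  fix t assume t: "s \<le> t" "t \<le> s'"
  define \<kappa> where "\<kappa> = poly p t / poly q t"
  have qt: "poly q t > 0" using q t by simp
  have "poly (p - smult \<kappa> q) t = 0" using qt by (simp add: \<kappa>_def)
  then obtain g where g: "p - smult \<kappa> q = [:-t, 1:] * g"
    using poly_eq_0_iff_dvd by blast
  have "sin (real 1 * (pi / 2)) * (poly g (- (- t)) * poly q (- (- t))) \<ge> 0"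
  proof (rule interlacing_at_root)
    fix u :: complex assume u: "Im u > 0"
    have G: "cpoly ([:- t, 1:] ^ 1 * g) u = cpoly p u - of_real \<kappa> * cpoly q u"
      unfolding power_one_right g[symmetric]
      using cpoly_add[of "p - smult \<kappa> q" "smult \<kappa> q" u] by (simp add: cpoly_smult)
    have "Im (cpoly ([:- t, 1:] ^ 1 * g) u * cnj (cpoly q u)) = Im (cpoly p u * cnj (cpoly q u))"
      unfolding G by (simp add: algebra_simps)
    with Im[OF u] show "0 \<le> Im (cpoly ([:- t, 1:] ^ 1 * g) u * cnj (cpoly q u))" by simp
  qed simp_all
  then have g_nonneg: "poly g t / poly q t \<ge> 0" using qt by (simp add: zero_le_mult_iff)
  have "((\<lambda>x. poly p x / poly q x) has_real_derivative poly g t / poly q t) (at t)"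
  proof -
    have D: "(poly p has_real_derivative poly (pderiv p) t) (at t)" "(poly q has_real_derivative poly (pderiv q) t) (at t)"
      by (rule poly_DERIV)+
    have "p = [:-t,1:] * g + smult \<kappa> q" unfolding g[symmetric] by simp
    then have "pderiv p = pderiv ([:-t,1:] * g) + smult \<kappa> (pderiv q)"
      by (metis pderiv_add pderiv_smult)
    then have "poly (pderiv p) t = poly g t + \<kappa> * poly (pderiv q) t"
      by (simp add: pderiv_mult pderiv_pCons del: mult_pCons_left)
    then have "poly g t / poly q t = (poly (pderiv p) t * poly q t - poly p t * poly (pderiv q) t) / (poly q t * poly q t)"
      using qt by (simp add: \<kappa>_def field_simps)
    with DERIV_divide[OF D] qt show ?thesis by simp
  qed
  with g_nonneg show "\<exists>y. ((\<lambda>x. poly p x / poly q x) has_real_derivative y) (at t) \<and> 0 \<le> y" by blast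
qed

text \<open>Such sums arise when all variables of a block \<open>B\<close> are shifted by one common
  amount. The top, subleading and linear coefficients computed next are the ones that the barrier
  step reads off.\<close>

lemma coeff_sum_monom_card:
  assumes "finite B"
  shows "coeff (\<Sum>S\<in>Pow B. monom (F S) (card S)) n = (\<Sum>S | S \<subseteq> B \<and> card S = n. F S)"
proof -
  have "coeff (\<Sum>S\<in>Pow B. monom (F S) (card S)) n = (\<Sum>S\<in>Pow B. if card S = n then F S else 0)"
    by (simp add: coeff_sum)
  also have "\<dots> = (\<Sum>S\<in>{S \<in> Pow B. card S = n}. F S)"
    using assms by (subst sum.inter_filter) auto
  finally show ?thesis by simp
qed

lemma coeff_sum_monom_card_top:
  assumes "finite B"
  shows "coeff (\<Sum>S\<in>Pow B. monom (F S) (card S)) (card B) = F B"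
proof -
  have "{S. S \<subseteq> B \<and> card S = card B} = {B}" using assms card_subset_eq by auto
  then show ?thesis by (simp add: coeff_sum_monom_card[OF assms])
qed

lemma coeff_sum_monom_card_one:
  assumes "finite B"
  shows "coeff (\<Sum>S\<in>Pow B. monom (F S) (card S)) 1 = (\<Sum>v\<in>B. F {v})"
proof -
  have "{S. S \<subseteq> B \<and> card S = 1} = (\<lambda>v. {v}) ` B" by (auto simp: card_Suc_eq)
  then show ?thesis by (simp add: coeff_sum_monom_card[OF assms] sum.reindex)
qed

lemma coeff_sum_monom_card_sub:
  assumes "finite B" "B \<noteq> {}"
  shows "coeff (\<Sum>S\<in>Pow B. monom (F S) (card S)) (card B - 1) = (\<Sum>v\<in>B. F (B - {v}))"
proof -
  have "S \<in> (\<lambda>v. B - {v}) ` B" if "S \<subseteq> B" "card S = card B - 1" for S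
  proof -
    have fS: "finite S" using that assms finite_subset by blast
    have "card (B - S) = 1" using that assms card_gt_0_iff[of B] by (simp add: card_Diff_subset[OF fS])
    then obtain v where "B - S = {v}" by (auto simp: card_Suc_eq)
    then have "S = B - {v}" "v \<in> B" using that by auto
    then show ?thesis by auto
  qed
  then have "{S. S \<subseteq> B \<and> card S = card B - 1} = (\<lambda>v. B - {v}) ` B" using assms by auto
  moreover have "inj_on (\<lambda>v. B - {v}) B" by (auto simp: inj_on_def)
  ultimately show ?thesis by (simp add: coeff_sum_monom_card[OF assms(1)] sum.reindex)
qed

lemma coeff_root_poly_1:
  "(\<And>d. d \<in> set ds \<Longrightarrow> d \<noteq> 0) \<Longrightarrow>
    coeff (root_poly ds) 1 = prod_list ds * sum_list (map inverse ds)"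
proof (induction ds)
  case (Cons d ds)
  have "coeff (root_poly (d # ds)) 1 = d * coeff (root_poly ds) 1 + coeff (root_poly ds) 0"
    by simp
  also have "coeff (root_poly ds) 0 = prod_list ds"
    using poly_root_poly_0[of ds] by (simp add: poly_0_coeff_0)
  also have "coeff (root_poly ds) 1 = prod_list ds * sum_list (map inverse ds)"
    using Cons by simp
  finally show ?case using Cons.prems[of d] by (simp add: algebra_simps)
qed simp

text \<open>Tangent form of the inequality between arithmetic and harmonic mean, summing d + t^2 / d
  \<ge> 2 t. With \<open>t\<close> free, an upper bound for the sum of the reciprocals can be
  inserted before \<open>t\<close> is optimised.\<close>

lemma sum_list_ge_harmonic:
  "(\<And>d. d \<in> set ds \<Longrightarrow> (0::real) < d) \<Longrightarrow>
    2 * t * real (length ds) - t\<^sup>2 * sum_list (map inverse ds) \<le> sum_list ds"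
proof (induction ds)
  case (Cons d ds)
  have "0 \<le> (d - t)\<^sup>2 / d" using Cons.prems[of d] by simp
  also have "(d - t)\<^sup>2 / d = d - 2 * t + t\<^sup>2 * inverse d"
    using Cons.prems[of d] by (simp add: power2_eq_square field_simps)
  finally show ?case using Cons by (simp add: algebra_simps)
qed simp

section \<open>Stable families\<close>

text \<open>\<open>T\<close> holds the variables already present and each block in \<open>bs\<close>
  still has to contribute one. Since blocks are nonempty, \<open>sorted_wrt disjnt\<close> also
  excludes repeated blocks.\<close>

definition admissible :: "'v set list \<Rightarrow> 'v set \<Rightarrow> bool" where
  "admissible bs T \<longleftrightarrow> finite T \<and> (\<forall>B\<in>set bs. finite B \<and> B \<noteq> {} \<and> B \<inter> T = {}) \<and> sorted_wrt disjnt bs"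

lemma admissible_Nil [simp]: "admissible [] T \<longleftrightarrow> finite T"
  by (simp add: admissible_def)

lemma admissible_Cons: "admissible (B # bs) T \<longleftrightarrow>
    finite B \<and> B \<noteq> {} \<and> B \<inter> T = {} \<and> B \<inter> \<Union>(set bs) = {} \<and> admissible bs T"
  by (auto simp: admissible_def disjnt_def)

lemma admissible_finite: "admissible bs T \<Longrightarrow> finite T"
  by (simp add: admissible_def)

lemma admissible_subset: "admissible bs T \<Longrightarrow> S \<subseteq> T \<Longrightarrow> admissible bs S"
  unfolding admissible_def by (blast intro: finite_subset)

lemma admissible_insert: "admissible (B # bs) T \<Longrightarrow> v \<in> B \<Longrightarrow> admissible bs (insert v T)"
  by (auto simp: admissible_def disjnt_def)

lemma admissible_notin: "admissible bs T \<Longrightarrow> v \<in> T \<Longrightarrow> v \<notin> \<Union>(set bs)"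
  by (auto simp: admissible_def)

text \<open>The abstract form of the polynomials \<open>det (diag z - A)\<close> restricted to the principal minor \<open>T\<close>:
  \<open>D_upd\<close> says that \<open>D T\<close> is affine in each variable \<open>v \<in> T\<close>, with partial derivative \<open>D (T - {v})\<close>,
  and \<open>D_nz\<close> that it is real stable.\<close>

locale stable_family =
  fixes D :: "'v set \<Rightarrow> ('v \<Rightarrow> complex) \<Rightarrow> complex"
  assumes D_empty: "D {} z = 1"
    and D_cong: "finite T \<Longrightarrow> (\<And>v. v \<in> T \<Longrightarrow> z v = z' v) \<Longrightarrow> D T z = D T z'"
    and D_upd: "finite T \<Longrightarrow> v \<in> T \<Longrightarrow> D T (z(v := w)) = D T z + (w - z v) * D (T - {v}) z"
    and D_cnj: "finite T \<Longrightarrow> D T (\<lambda>v. cnj (z v)) = cnj (D T z)"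
    and D_nz: "finite T \<Longrightarrow> (\<And>v. Im (z v) > 0) \<Longrightarrow> D T z \<noteq> 0"
begin

text \<open>The sum of \<open>D\<close> over all ways of adding to \<open>T\<close> one element of each block of \<open>bs\<close>.\<close>

primrec E :: "'v set list \<Rightarrow> 'v set \<Rightarrow> ('v \<Rightarrow> complex) \<Rightarrow> complex" where
  "E [] T z = D T z"
| "E (B # bs) T z = (\<Sum>v\<in>B. E bs (insert v T) z)"

lemmas E_Nil = E.simps(1) and E_Cons = E.simps(2)

lemma E_cong:
  "admissible bs T \<Longrightarrow> (\<And>v. v \<in> T \<union> \<Union>(set bs) \<Longrightarrow> z v = z' v) \<Longrightarrow> E bs T z = E bs T z'"
proof (induction bs arbitrary: T)
  case Nil then show ?case by (auto intro: D_cong)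
next
  case (Cons B bs)
  show ?case unfolding E_Nil E_Cons
    by (rule sum.cong[OF refl], rule Cons.IH[OF admissible_insert[OF Cons.prems(1)]]) (use Cons.prems(2) in auto)
qed

lemma E_upd:
  "admissible bs T \<Longrightarrow> v \<in> T \<Longrightarrow> E bs T (z(v := w)) = E bs T z + (w - z v) * E bs (T - {v}) z"
proof (induction bs arbitrary: T)
  case Nil then show ?case unfolding E_Nil E_Cons by (intro D_upd) auto
next
  case (Cons B bs)
  have "E bs (insert u T) (z(v := w)) = E bs (insert u T) z + (w - z v) * E bs (insert u (T - {v})) z"
    if "u \<in> B" for u
  proof -
    have "u \<noteq> v" using Cons.prems that by (auto simp: admissible_Cons)
    then have eq: "insert u T - {v} = insert u (T - {v})" by auto
    show ?thesis
      using Cons.IH[OF admissible_insert[OF Cons.prems(1) that] insertI2[OF Cons.prems(2)]] unfolding eq .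
  qed
  then have "E (B # bs) T (z(v := w)) = (\<Sum>u\<in>B. E bs (insert u T) z + (w - z v) * E bs (insert u (T - {v})) z)"
    unfolding E_Cons by (rule sum.cong[OF refl])
  also have "\<dots> = E (B # bs) T z + (w - z v) * E (B # bs) (T - {v}) z"
    by (simp add: sum.distrib sum_distrib_left)
  finally show ?case .
qed

text \<open>Here \<open>v\<close> may also lie in a block, where only some summands contain it, or
  nowhere at all. The slope is therefore written as a difference of two values and not as some
  \<open>E bs (T - {v})\<close>.\<close>

lemma E_affine:
  "admissible bs T \<Longrightarrow> E bs T (z(v := w)) = E bs T (z(v := 0)) + w * (E bs T (z(v := 1)) - E bs T (z(v := 0)))"
proof (induction bs arbitrary: T)
  case Nil
  show ?case
  proof (cases "v \<in> T")
    case True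
    with Nil have "D T (z(v := x)) = D T z + (x - z v) * D (T - {v}) z" for x by (intro D_upd) auto
    then show ?thesis unfolding E_Nil E_Cons by (simp only:) (simp add: algebra_simps)
  next
    case False
    with Nil have "D T (z(v := x)) = D T z" for x by (intro D_cong) auto
    then show ?thesis unfolding E_Nil E_Cons by (simp only:) simp
  qed
next
  case (Cons B bs)
  have "E bs (insert u T) (z(v := w)) = E bs (insert u T) (z(v := 0))
      + w * (E bs (insert u T) (z(v := 1)) - E bs (insert u T) (z(v := 0)))" if "u \<in> B" for u
    by (rule Cons.IH[OF admissible_insert[OF Cons.prems that]])
  then have "E (B # bs) T (z(v := w)) = (\<Sum>u\<in>B. E bs (insert u T) (z(v := 0))
      + w * (E bs (insert u T) (z(v := 1)) - E bs (insert u T) (z(v := 0))))"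
    unfolding E_Cons by (rule sum.cong[OF refl])
  also have "\<dots> = E (B # bs) T (z(v := 0)) + w * (E (B # bs) T (z(v := 1)) - E (B # bs) T (z(v := 0)))"
    by (simp add: sum.distrib sum_subtractf flip: sum_distrib_left)
  finally show ?case .
qed

lemma E_cnj: "admissible bs T \<Longrightarrow> E bs T (\<lambda>v. cnj (z v)) = cnj (E bs T z)"
proof (induction bs arbitrary: T)
  case Nil then show ?case by (simp add: D_cnj)
next
  case (Cons B bs)
  show ?case unfolding E_Nil E_Cons cnj_sum
    by (rule sum.cong[OF refl], rule Cons.IH[OF admissible_insert[OF Cons.prems]])
qed

text \<open>If the ratio g / h had too small an imaginary part, replacing z v by z v - g / h would
  stay in the upper half-plane and make the affine function vanish. Nonvanishing is a hypothesis
  because the induction for \<open>E_nz\<close> supplies it only for the shorter list.\<close>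

lemma Im_E_ratio_aux:
  assumes nz: "\<And>S z. admissible bs S \<Longrightarrow> (\<And>v. Im (z v) > 0) \<Longrightarrow> E bs S z \<noteq> 0"
    and T: "admissible bs T" "v \<in> T" and z: "\<And>v. Im (z v) > 0"
  shows "Im (E bs T z / E bs (T - {v}) z) \<ge> Im (z v)"
proof (rule ccontr)
  define g h where "g = E bs T z" and "h = E bs (T - {v}) z"
  assume "\<not> ?thesis"
  then have "Im (z v - g / h) > 0" by (simp add: g_def h_def)
  moreover have h: "h \<noteq> 0" unfolding h_def
    by (rule nz) (use T z in \<open>auto intro: admissible_subset\<close>)
  ultimately have "E bs T (z(v := z v - g / h)) \<noteq> 0"
    using T z by (intro nz) auto
  then show False using h by (simp add: E_upd[OF T] g_def h_def)
qed

text \<open>Stability survives the sum over a block: divided by \<open>E bs T z\<close>, every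
  summand has positive imaginary part, so the sum cannot vanish.\<close>

lemma E_nz: "admissible bs T \<Longrightarrow> (\<And>v. Im (z v) > 0) \<Longrightarrow> E bs T z \<noteq> 0"
proof (induction bs arbitrary: T z)
  case Nil then show ?case by (simp add: D_nz)
next
  case (Cons B bs)
  have B: "finite B" "B \<noteq> {}" "B \<inter> T = {}" and T: "admissible bs T" using Cons.prems(1) by (auto simp: admissible_Cons)
  have "0 < (\<Sum>v\<in>B. Im (z v))" using B Cons.prems(2) by (intro sum_pos) auto
  also have "\<dots> \<le> (\<Sum>v\<in>B. Im (E bs (insert v T) z / E bs T z))"
  proof (rule sum_mono)
    fix v assume v: "v \<in> B"
    then have "insert v T - {v} = T" using B by auto
    with Im_E_ratio_aux[OF Cons.IH admissible_insert[OF Cons.prems(1) v] insertI1 Cons.prems(2)]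
    show "Im (z v) \<le> Im (E bs (insert v T) z / E bs T z)" by simp
  qed
  also have "\<dots> = Im (E (B # bs) T z / E bs T z)" by (simp add: sum_divide_distrib)
  finally show ?case by auto
qed

text \<open>Taylor expansion of a function affine in each variable of \<open>X\<close>:
  differentiating once in every variable of \<open>S\<close> deletes \<open>S\<close> from
  \<open>T\<close>.\<close>

lemma E_shift:
  "finite X \<Longrightarrow> admissible bs T \<Longrightarrow> X \<subseteq> T \<Longrightarrow>
    E bs T (\<lambda>v. if v \<in> X then z v + u else z v) = (\<Sum>S\<in>Pow X. u ^ card S * E bs (T - S) z)"
proof (induction X arbitrary: T rule: finite_induct)
  case (insert x X)
  let ?z = "\<lambda>v. if v \<in> X then z v + u else z v"
  have eq: "(\<lambda>v. if v \<in> insert x X then z v + u else z v) = ?z(x := z x + u)"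
    using insert.hyps by auto
  have "z x + u - ?z x = u" using insert.hyps by simp
  then have "E bs T (\<lambda>v. if v \<in> insert x X then z v + u else z v) = E bs T ?z + u * E bs (T - {x}) ?z"
    using E_upd[of bs T x ?z "z x + u"] insert.prems unfolding eq by (simp only: insert_subset simp_thms)
  also have "E bs T ?z = (\<Sum>S\<in>Pow X. u ^ card S * E bs (T - S) z)"
    using insert.prems by (intro insert.IH) auto
  also have "E bs (T - {x}) ?z = (\<Sum>S\<in>Pow X. u ^ card S * E bs (T - {x} - S) z)"
    by (rule insert.IH) (use insert.prems insert.hyps admissible_subset[of bs T "T - {x}"] in auto)
  also have "u * \<dots> = (\<Sum>S\<in>Pow X. u ^ card (insert x S) * E bs (T - insert x S) z)"
    unfolding sum_distrib_left
  proof (rule sum.cong[OF refl])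
    fix S assume S: "S \<in> Pow X"
    then have "card (insert x S) = Suc (card S)"
      using insert by (intro card_insert_disjoint) (auto intro: finite_subset)
    moreover have "T - {x} - S = T - insert x S" by auto
    ultimately show "u * (u ^ card S * E bs (T - {x} - S) z) = u ^ card (insert x S) * E bs (T - insert x S) z"
      by simp
  qed
  also have "\<dots> = (\<Sum>S\<in>insert x ` Pow X. u ^ card S * E bs (T - S) z)"
  proof -
    have "inj_on (insert x) (Pow X)"
      by (rule inj_onI) (metis insert_ident PowD insert.hyps(2) subsetD)
    then show ?thesis by (subst sum.reindex) auto
  qed
  also have "(\<Sum>S\<in>Pow X. u ^ card S * E bs (T - S) z) + \<dots> = (\<Sum>S\<in>Pow (insert x X). u ^ card S * E bs (T - S) z)"
    unfolding Pow_insert using insert by (subst sum.union_disjoint) auto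
  finally show ?case .
qed auto

lemma continuous_E_shift: "admissible bs T \<Longrightarrow> continuous_on S (\<lambda>c. E bs T (\<lambda>v. z v + c))"
proof (induction bs arbitrary: T)
  case Nil
  have "D T (\<lambda>v. z v + c) = (\<Sum>S\<in>Pow T. c ^ card S * D (T - S) z)" for c
    using E_shift[of T "[]" T z c] Nil D_cong[of T "\<lambda>v. z v + c" "\<lambda>v. if v \<in> T then z v + c else z v"]
    by simp
  then show ?case by (auto intro!: continuous_intros)
next
  case (Cons B bs)
  show ?case unfolding E_Nil E_Cons
    by (intro continuous_on_sum Cons.IH admissible_insert[OF Cons.prems])
qed

text \<open>The bound on \<open>Im (E bs T z / E bs (T - {v}) z)\<close>, cleared of denominators so that it passes to
  the closed half-plane and in particular to real points.\<close>

lemma Im_E_mult_cnj: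
  assumes T: "admissible bs T" "v \<in> T" and z: "\<And>v. Im (z v) \<ge> 0"
  shows "Im (E bs T z * cnj (E bs (T - {v}) z)) \<ge> Im (z v) * (cmod (E bs (T - {v}) z))\<^sup>2"
proof -
  define F where "F = (\<lambda>S (e::real). E bs S (\<lambda>v. z v + \<i> * of_real e))"
  have lim: "(F S \<longlongrightarrow> F S 0) (at_right 0)" if "admissible bs S" for S
  proof -
    have "continuous_on UNIV (F S)" unfolding F_def
      by (rule continuous_on_compose2[OF continuous_E_shift[OF that]]) (auto intro!: continuous_intros)
    then show ?thesis by (metis UNIV_I continuous_on_def open_UNIV tendsto_within_subset subset_UNIV)
  qed
  let ?G = "\<lambda>e. Im (F T e * cnj (F (T - {v}) e)) - (Im (z v) + e) * (cmod (F (T - {v}) e))\<^sup>2"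
  have "(?G \<longlongrightarrow> ?G 0) (at_right 0)"
    using T by (intro tendsto_intros lim) (auto intro: admissible_subset)
  moreover have "eventually (\<lambda>e. ?G e \<ge> 0) (at_right 0)"
  proof (rule eventually_at_right_less[THEN eventually_mono])
    fix e :: real assume e: "0 < e"
    let ?z = "\<lambda>v. z v + \<i> * of_real e"
    have z': "Im (?z u) > 0" for u using z[of u] e by simp
    have nz: "F (T - {v}) e \<noteq> 0" unfolding F_def
      by (rule E_nz) (use T z' in \<open>auto intro: admissible_subset\<close>)
    have "Im (F T e * cnj (F (T - {v}) e)) = Im (F T e / F (T - {v}) e) * (cmod (F (T - {v}) e))\<^sup>2"
    proof -
      have "F T e * cnj (F (T - {v}) e) = F T e / F (T - {v}) e * of_real ((cmod (F (T - {v}) e))\<^sup>2)"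
        unfolding complex_norm_square using nz by simp
      then show ?thesis by (simp only: times_complex.sel Im_complex_of_real Re_complex_of_real mult_zero_right add_0_left)
    qed
    moreover have "Im (F T e / F (T - {v}) e) \<ge> Im (z v) + e"
      using Im_E_ratio_aux[OF E_nz T, of ?z] z' by (simp add: F_def)
    ultimately show "?G e \<ge> 0" by (simp add: mult_right_mono)
  qed
  ultimately have "?G 0 \<ge> 0" by (rule tendsto_lowerbound) simp
  then show ?thesis by (simp add: F_def)
qed

section \<open>Values at real points\<close>

definition er :: "'v set list \<Rightarrow> 'v set \<Rightarrow> ('v \<Rightarrow> real) \<Rightarrow> real" where
  "er bs T y = Re (E bs T (\<lambda>v. of_real (y v)))"

lemma E_real: "admissible bs T \<Longrightarrow> E bs T (\<lambda>v. of_real (y v)) = of_real (er bs T y)"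
  using E_cnj[of bs T "\<lambda>v. of_real (y v)"] by (simp add: er_def complex_eq_iff)

lemma er_Cons: "er (B # bs) T y = (\<Sum>v\<in>B. er bs (insert v T) y)"
  by (simp add: er_def)

lemma er_empty: "er [] {} y = 1"
  by (simp add: er_def D_empty)

lemma er_cong:
  "admissible bs T \<Longrightarrow> (\<And>v. v \<in> T \<union> \<Union>(set bs) \<Longrightarrow> y v = y' v) \<Longrightarrow> er bs T y = er bs T y'"
  unfolding er_def by (subst E_cong[of bs T _ "\<lambda>v. of_real (y' v)"]) auto

lemma of_real_upd: "(\<lambda>u. of_real ((y(v := x)) u)) = (\<lambda>u. of_real (y u) :: complex)(v := of_real x)"
  by auto

lemma E_real_upd:
  "admissible bs T \<Longrightarrow> E bs T ((\<lambda>u. of_real (y u))(v := of_real x)) = of_real (er bs T (y(v := x)))"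
  using E_real[of bs T "y(v := x)"] unfolding of_real_upd .

lemma er_upd:
  assumes "admissible bs T" "v \<in> T"
  shows "er bs T (y(v := x)) = er bs T y + (x - y v) * er bs (T - {v}) y"
proof -
  have "admissible bs (T - {v})" using assms by (auto intro: admissible_subset)
  then have "complex_of_real (er bs T (y(v := x))) = of_real (er bs T y + (x - y v) * er bs (T - {v}) y)"
    using E_upd[OF assms, of "\<lambda>u. of_real (y u)" "of_real x"] assms
    unfolding E_real_upd[OF assms(1)] by (simp add: E_real)
  then show ?thesis by (simp only: of_real_eq_iff)
qed

lemma er_shift:
  assumes "admissible bs T" "X \<subseteq> T"
  shows "er bs T (\<lambda>v. if v \<in> X then y v + u else y v) = (\<Sum>S\<in>Pow X. u ^ card S * er bs (T - S) y)"
proof -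
  have fin: "finite X" using assms admissible_finite finite_subset by blast
  have "complex_of_real (er bs T (\<lambda>v. if v \<in> X then y v + u else y v))
      = E bs T (\<lambda>v. of_real (if v \<in> X then y v + u else y v))"
    using assms by (simp only: E_real)
  also have "(\<lambda>v. complex_of_real (if v \<in> X then y v + u else y v))
      = (\<lambda>v. if v \<in> X then of_real (y v) + of_real u else of_real (y v))" by auto
  also have "E bs T \<dots> = (\<Sum>S\<in>Pow X. of_real u ^ card S * E bs (T - S) (\<lambda>v. of_real (y v)))"
    using assms fin by (intro E_shift)
  also have "\<dots> = of_real (\<Sum>S\<in>Pow X. u ^ card S * er bs (T - S) y)"
    unfolding of_real_sum using assms by (intro sum.cong refl) (simp add: E_real admissible_subset[of bs T])
  finally show ?thesis by (simp only: of_real_eq_iff)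
qed

lemma continuous_er_shift:
  assumes "admissible bs T" shows "continuous_on S (\<lambda>s. er bs T (\<lambda>v. y v + s))"
  unfolding er_def of_real_add
  by (intro continuous_on_Re continuous_on_compose2[OF continuous_E_shift[OF assms, of UNIV]])
    (auto intro!: continuous_intros)

text \<open>In a single variable the ratio is a real Moebius map that preserves the upper half-plane.\<close>

lemma er_ratio_mono1:
  assumes T: "admissible bs (insert v T)" "v \<notin> T" and x: "x \<le> x'"
    and positive_above: "er bs T (y(w := x)) * er bs T (y(w := x')) > 0"
  shows "er bs (insert v T) (y(w := x)) / er bs T (y(w := x))
       \<le> er bs (insert v T) (y(w := x')) / er bs T (y(w := x'))"
proof -
  have T': "admissible bs T" using T by (auto intro: admissible_subset)
  define a b where "a = er bs (insert v T) (y(w := 0))" and "b = er bs (insert v T) (y(w := 1)) - a"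
  define c d where "c = er bs T (y(w := 0))" and "d = er bs T (y(w := 1)) - c"
  let ?z = "\<lambda>u. complex_of_real (y u)"
  have f: "E bs (insert v T) (?z(w := t)) = of_real a + t * of_real b" for t
    using E_affine[OF T(1), of ?z w t] E_real_upd[OF T(1), of y w 0] E_real_upd[OF T(1), of y w 1]
    by (simp add: a_def b_def)
  have h: "E bs T (?z(w := t)) = of_real c + t * of_real d" for t
    using E_affine[OF T', of ?z w t] E_real_upd[OF T', of y w 0] E_real_upd[OF T', of y w 1]
    by (simp add: c_def d_def)
  have "0 \<le> Im ((?z(w := \<i>)) v) * (cmod (E bs T (?z(w := \<i>))))\<^sup>2" by auto
  also have "\<dots> \<le> Im (E bs (insert v T) (?z(w := \<i>)) * cnj (E bs T (?z(w := \<i>))))"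
    using Im_E_mult_cnj[OF T(1) insertI1, of "?z(w := \<i>)"] T(2) by auto
  also have "\<dots> = b * c - a * d" unfolding f h by (simp add: algebra_simps)
  finally have det: "0 \<le> b * c - a * d" .
  have fr: "er bs (insert v T) (y(w := t)) = a + t * b" for t
    unfolding er_def of_real_upd f by simp
  have hr: "er bs T (y(w := t)) = c + t * d" for t
    unfolding er_def of_real_upd h by simp
  from positive_above have P: "(c + x * d) * (c + x' * d) > 0" by (simp add: hr)
  then have "c + x * d \<noteq> 0" "c + x' * d \<noteq> 0" by force+
  then have "(a + x' * b) / (c + x' * d) - (a + x * b) / (c + x * d)
      = (b * c - a * d) * (x' - x) / ((c + x * d) * (c + x' * d))"
    by (subst diff_frac_eq) (simp_all add: algebra_simps)
  also have "\<dots> \<ge> 0" using det x P by (intro divide_nonneg_pos mult_nonneg_nonneg) auto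
  finally show ?thesis by (simp add: fr hr)
qed

text \<open>The variables are raised one at a time, and all intermediate points stay in the box
  between \<open>y\<close> and \<open>y'\<close>. The sign \<sigma> admits negative denominators,
  which occur below the roots in \<open>er_sign_below\<close>.\<close>

lemma er_ratio_mono:
  assumes T: "admissible bs (insert v T)" "v \<notin> T" and y: "y \<le> y'"
    and positive_above: "\<And>x. y \<le> x \<Longrightarrow> x \<le> y' \<Longrightarrow> \<sigma> * er bs T x > 0"
  shows "er bs (insert v T) y / er bs T y \<le> er bs (insert v T) y' / er bs T y'"
proof -
  let ?R = "\<lambda>x. er bs (insert v T) x / er bs T x"
  let ?m = "\<lambda>F u. if u \<in> F then y' u else y u"
  have yy: "y u \<le> y' u" for u using y by (simp add: le_fun_def)
  have "?R y \<le> ?R (?m F)" if "finite F" for F using that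
  proof induction
    case (insert w F)
    have e1: "(?m F)(w := y w) = ?m F" using insert by auto
    have e2: "(?m F)(w := y' w) = ?m (insert w F)" by auto
    have "\<sigma> * er bs T (?m F) > 0" "\<sigma> * er bs T (?m (insert w F)) > 0"
      by (intro positive_above; auto simp: le_fun_def yy)+
    then have "er bs T (?m F) * er bs T (?m (insert w F)) > 0"
      by (smt (verit) zero_less_mult_iff)
    then have "?R (?m F) \<le> ?R (?m (insert w F))"
      using er_ratio_mono1[OF T yy[of w], of "?m F" w] unfolding e1 e2 by simp
    then show ?case using insert by linarith
  qed simp
  moreover have "finite (insert v T \<union> \<Union>(set bs))" using T by (auto simp: admissible_def)
  moreover have "er bs (insert v T) (?m (insert v T \<union> \<Union>(set bs))) = er bs (insert v T) y'"
    by (rule er_cong[OF T(1)]) auto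
  moreover have "er bs T (?m (insert v T \<union> \<Union>(set bs))) = er bs T y'"
    by (rule er_cong) (use T in \<open>auto intro: admissible_subset\<close>)
  ultimately show ?thesis by metis
qed

text \<open>Leading behaviour as the variables in \<open>X\<close> go to infinity together: each
  variable of \<open>T\<close> in \<open>X\<close> gives one power of s, each block gives one more
  power and a choice among \<open>card B\<close> variables, and what remains is the minor on
  \<open>T - X\<close>.\<close>

lemma er_limit:
  assumes "admissible bs T" "\<Union>(set bs) \<subseteq> X"
  shows "((\<lambda>s. er bs T (\<lambda>v. if v \<in> X then y v + s else y v) / s ^ (card (T \<inter> X) + length bs))
      \<longlongrightarrow> (\<Prod>B\<leftarrow>bs. real (card B)) * er [] (T - X) y) at_top"
  using assms
proof (induction bs arbitrary: T)
  case Nil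
  let ?n = "card (T \<inter> X)"
  have fin: "finite T" using Nil by simp
  have eq: "er [] T (\<lambda>v. if v \<in> X then y v + s else y v)
      = (\<Sum>S\<in>Pow (T \<inter> X). s ^ card S * er [] (T - S) y)" for s
    using er_shift[of "[]" T "T \<inter> X" y s] fin
      er_cong[of "[]" T "\<lambda>v. if v \<in> X then y v + s else y v" "\<lambda>v. if v \<in> T \<inter> X then y v + s else y v"]
    by simp
  have "((\<lambda>s. \<Sum>S\<in>Pow (T \<inter> X). s ^ card S * er [] (T - S) y / s ^ ?n)
     \<longlongrightarrow> (\<Sum>S\<in>Pow (T \<inter> X). if S = T \<inter> X then er [] (T - S) y else 0)) at_top"
  proof (rule tendsto_sum)
    fix S assume S: "S \<in> Pow (T \<inter> X)"
    show "((\<lambda>s. s ^ card S * er [] (T - S) y / s ^ ?n)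
       \<longlongrightarrow> (if S = T \<inter> X then er [] (T - S) y else 0)) at_top"
    proof (cases "S = T \<inter> X")
      case True
      have "eventually (\<lambda>s. er [] (T - S) y = s ^ card S * er [] (T - S) y / s ^ ?n) at_top"
        using eventually_gt_at_top[of 0] by eventually_elim (simp add: True)
      from tendsto_cong[OF this, of "er [] (T - S) y"] show ?thesis using True by simp
    next
      case False
      then have lt: "card S < ?n" using S fin by (intro psubset_card_mono) auto
      have "((\<lambda>s. er [] (T - S) y * inverse (s ^ (?n - card S))) \<longlongrightarrow> er [] (T - S) y * 0) at_top"
        using lt by (intro tendsto_intros tendsto_inverse_0_at_top filterlim_pow_at_top filterlim_ident) auto
      moreover have "eventually (\<lambda>s. er [] (T - S) y * inverse (s ^ (?n - card S))
          = s ^ card S * er [] (T - S) y / s ^ ?n) at_top"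
        using eventually_gt_at_top[of 0]
      proof eventually_elim
        case (elim s)
        have "s ^ ?n = s ^ (?n - card S) * s ^ card S" using lt by (simp flip: power_add)
        then show ?case using elim by (simp add: field_simps)
      qed
      ultimately show ?thesis using False
        by (subst tendsto_cong[symmetric]) (auto elim: eventually_mono)
    qed
  qed
  then show ?case using fin by (simp add: eq sum_divide_distrib sum.delta' Diff_Int)
next
  case (Cons B bs)
  have B: "finite B" "B \<inter> T = {}" "B \<subseteq> X" using Cons.prems by (auto simp: admissible_Cons)
  have fin: "finite T" using Cons.prems(1) by (rule admissible_finite)
  let ?s = "\<lambda>s v. if v \<in> X then y v + s else y v"
  have "((\<lambda>s. \<Sum>v\<in>B. er bs (insert v T) (?s s) / s ^ (card (T \<inter> X) + length (B # bs)))
     \<longlongrightarrow> (\<Sum>v\<in>B. (\<Prod>B\<leftarrow>bs. real (card B)) * er [] (T - X) y)) at_top"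
  proof (rule tendsto_sum)
    fix v assume v: "v \<in> B"
    have "insert v T \<inter> X = insert v (T \<inter> X)" "v \<notin> T" "insert v T - X = T - X" using v B by auto
    then show "((\<lambda>s. er bs (insert v T) (?s s) / s ^ (card (T \<inter> X) + length (B # bs)))
      \<longlongrightarrow> (\<Prod>B\<leftarrow>bs. real (card B)) * er [] (T - X) y) at_top"
      using Cons.IH[OF admissible_insert[OF Cons.prems(1) v]] Cons.prems(2) fin by simp
  qed
  then show ?case by (simp add: er_Cons sum_divide_distrib mult.assoc)
qed

lemma card_prod_pos: "admissible bs T \<Longrightarrow> (\<Prod>B\<leftarrow>bs. real (card B)) > 0"
  by (induction bs) (auto simp: admissible_Cons card_gt_0_iff)

lemma eventually_er_pos:
  assumes "admissible bs T" shows "eventually (\<lambda>s. er bs T (\<lambda>v. y v + s) > 0) at_top"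
proof -
  have "((\<lambda>s. er bs T (\<lambda>v. y v + s) / s ^ (card T + length bs)) \<longlongrightarrow> (\<Prod>B\<leftarrow>bs. real (card B))) at_top"
    using er_limit[OF assms, of UNIV y] by (simp add: er_empty)
  from order_tendstoD(1)[OF this card_prod_pos[OF assms]] eventually_gt_at_top[of 0]
  show ?thesis
  proof eventually_elim
    case (elim s)
    then show ?case using zero_less_power[of s "card T + length bs"] by (auto simp: zero_less_divide_iff)
  qed
qed

lemma E_diag_poly: "admissible bs T \<Longrightarrow> \<exists>p. \<forall>c. E bs T (\<lambda>v. of_real (y v) + c) = cpoly p c"
proof (induction bs arbitrary: T)
  case Nil
  have "E [] T (\<lambda>v. of_real (y v) + c) = cpoly (\<Sum>S\<in>Pow T. monom (er [] (T - S) y) (card S)) c" for c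
  proof -
    have "E [] T (\<lambda>v. of_real (y v) + c) = E [] T (\<lambda>v. if v \<in> T then of_real (y v) + c else of_real (y v))"
      using Nil by (intro E_cong) auto
    also have "\<dots> = (\<Sum>S\<in>Pow T. c ^ card S * E [] (T - S) (\<lambda>v. of_real (y v)))"
      using Nil by (intro E_shift) auto
    also have "\<dots> = (\<Sum>S\<in>Pow T. c ^ card S * of_real (er [] (T - S) y))"
      using Nil by (intro sum.cong refl arg_cong2[of _ _ _ _ "(*)"] E_real) auto
    finally show ?thesis by (simp add: cpoly_sum cpoly_monom mult.commute)
  qed
  then show ?case by blast
next
  case (Cons B bs)
  have "\<forall>v\<in>B. \<exists>p. \<forall>c. E bs (insert v T) (\<lambda>v. of_real (y v) + c) = cpoly p c"
    using Cons.IH[OF admissible_insert[OF Cons.prems]] by blast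
  then obtain p where "\<And>v c. v \<in> B \<Longrightarrow> E bs (insert v T) (\<lambda>v. of_real (y v) + c) = cpoly (p v) c"
    by metis
  then have "E (B # bs) T (\<lambda>v. of_real (y v) + c) = cpoly (sum p B) c" for c
    unfolding E_Cons cpoly_sum by (rule sum.cong[OF refl])
  then show ?case by blast
qed

text \<open>In contrast to \<open>er_ratio_mono\<close>, the denominator has to be positive only on
  the diagonal segment and not on a box. This is what \<open>ray_positive\<close> can offer when the
  positivity of the denominator is still to be shown.\<close>

lemma er_diag_ratio_mono:
  assumes T: "admissible bs (insert v T)" "v \<notin> T" and s: "s \<le> s'"
    and positive_above: "\<And>t. s \<le> t \<Longrightarrow> t \<le> s' \<Longrightarrow> er bs T (\<lambda>u. y u + t) > 0"
  shows "er bs (insert v T) (\<lambda>u. y u + s) / er bs T (\<lambda>u. y u + s)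
       \<le> er bs (insert v T) (\<lambda>u. y u + s') / er bs T (\<lambda>u. y u + s')"
proof -
  have T': "admissible bs T" using T by (auto intro: admissible_subset)
  obtain p where p: "\<And>c. E bs (insert v T) (\<lambda>v. of_real (y v) + c) = cpoly p c"
    using E_diag_poly[OF T(1)] by blast
  obtain q where q: "\<And>c. E bs T (\<lambda>v. of_real (y v) + c) = cpoly q c"
    using E_diag_poly[OF T'] by blast
  have p': "er bs (insert v T) (\<lambda>u. y u + t) = poly p t" for t
    using p[of "of_real t"] by (simp add: er_def cpoly_of_real)
  have q': "er bs T (\<lambda>u. y u + t) = poly q t" for t
    using q[of "of_real t"] by (simp add: er_def cpoly_of_real)
  show ?thesis unfolding p' q'
  proof (rule poly_ratio_mono[OF _ s])
    fix u :: complex assume u: "Im u > 0"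
    then have "0 \<le> Im (of_real (y v) + u) * (cmod (E bs T (\<lambda>v. of_real (y v) + u)))\<^sup>2" by simp
    also have "\<dots> \<le> Im (cpoly p u * cnj (cpoly q u))"
      using Im_E_mult_cnj[OF T(1) insertI1, of "\<lambda>v. of_real (y v) + u"] u T(2) by (simp add: p q)
    finally show "0 \<le> Im (cpoly p u * cnj (cpoly q u))" .
  qed (use positive_above q' in auto)
qed

subsection \<open>Points above the roots\<close>

text \<open>The multivariate substitute for lying above the largest root: the whole orthant with
  corner \<open>y\<close> is free of zeros, with the sign found at infinity.\<close>

definition positive_above :: "'v set list \<Rightarrow> 'v set \<Rightarrow> ('v \<Rightarrow> real) \<Rightarrow> bool" where
  "positive_above bs T y \<longleftrightarrow> (\<forall>x. y \<le> x \<longrightarrow> er bs T x > 0)"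

lemma positive_aboveD: "positive_above bs T y \<Longrightarrow> y \<le> x \<Longrightarrow> er bs T x > 0"
  by (simp add: positive_above_def)

lemma positive_above_cong:
  assumes T: "admissible bs T" and p: "positive_above bs T y" and le: "\<And>v. v \<in> T \<union> \<Union>(set bs) \<Longrightarrow> y v \<le> x v"
  shows "er bs T x > 0"
proof -
  have "er bs T x = er bs T (\<lambda>v. max (y v) (x v))"
    using le by (intro er_cong[OF T]) (auto simp: max_def)
  then show ?thesis using positive_aboveD[OF p, of "\<lambda>v. max (y v) (x v)"] by (simp add: le_fun_def)
qed

text \<open>The analogue of the fact that the derivative of a real-rooted polynomial has no root
  above the largest one: along a diagonal ray the ratio to the derivative increases, so
  \<open>ray_positive\<close> carries positivity down from infinity.\<close>

lemma positive_above_remove: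
  assumes T: "admissible bs T" "v \<in> T" and p: "positive_above bs T y"
  shows "positive_above bs (T - {v}) y"
  unfolding positive_above_def
proof (intro allI impI)
  fix x assume x: "y \<le> x"
  have T': "admissible bs (T - {v})" using T by (auto intro: admissible_subset)
  have ins: "insert v (T - {v}) = T" using T by auto
  have le: "y \<le> (\<lambda>u. x u + s)" if "s \<ge> 0" for s
    using x that by (auto simp: le_fun_def intro: add_increasing2)
  have "er bs (T - {v}) (\<lambda>u. x u + 0) > 0"
  proof (rule ray_positive[where f = "\<lambda>s. er bs T (\<lambda>u. x u + s)"])
    fix s s' :: real
    assume "s \<le> s'" and "\<And>t. s \<le> t \<Longrightarrow> t \<le> s' \<Longrightarrow> er bs (T - {v}) (\<lambda>u. x u + t) > 0"
    then show "er bs T (\<lambda>u. x u + s) / er bs (T - {v}) (\<lambda>u. x u + s)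
        \<le> er bs T (\<lambda>u. x u + s') / er bs (T - {v}) (\<lambda>u. x u + s')"
      using er_diag_ratio_mono[of bs v "T - {v}" s s' x] T unfolding ins by simp
  qed (use T T' le p in \<open>auto intro: continuous_er_shift eventually_er_pos positive_aboveD\<close>)
  then show "er bs (T - {v}) x > 0" by simp
qed

lemma positive_above_subset:
  assumes "admissible bs T" "S \<subseteq> T" "positive_above bs T y"
  shows "positive_above bs S y"
proof -
  have "positive_above bs (T - X) y" if "finite X" for X using that
  proof induction
    case (insert v X)
    have eq: "T - insert v X = T - X - {v}" by auto
    show ?case
    proof (cases "v \<in> T - X")
      case True
      then show ?thesis unfolding eq using insert assms(1)
        by (intro positive_above_remove) (auto intro: admissible_subset)
    next
      case False
      then have "T - insert v X = T - X" by auto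
      then show ?thesis using insert by simp
    qed
  qed (use assms in simp)
  from this[of "T - S"] show ?thesis using assms admissible_finite[OF assms(1)] by (simp add: double_diff)
qed

text \<open>The sum over \<open>B\<close> divided by \<open>er bs T\<close> is a sum of increasing
  ratios, so the argument for a single derivative applies to it as a whole.\<close>

lemma positive_above_pop:
  assumes T: "admissible (B # bs) T" and p: "positive_above (B # bs) T y"
  shows "positive_above bs T y"
  unfolding positive_above_def
proof (intro allI impI)
  fix x assume x: "y \<le> x"
  have T': "admissible bs T" using T by (simp add: admissible_Cons)
  have le: "y \<le> (\<lambda>u. x u + s)" if "s \<ge> 0" for s
    using x that by (auto simp: le_fun_def intro: add_increasing2)
  have "er bs T (\<lambda>u. x u + 0) > 0"
  proof (rule ray_positive[where f = "\<lambda>s. er (B # bs) T (\<lambda>u. x u + s)"])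
    fix s s' :: real
    assume s: "0 \<le> s" "s \<le> s'" and e: "\<And>t. s \<le> t \<Longrightarrow> t \<le> s' \<Longrightarrow> er bs T (\<lambda>u. x u + t) > 0"
    have "v \<notin> T" if "v \<in> B" for v using T that by (auto simp: admissible_Cons)
    then show "er (B # bs) T (\<lambda>u. x u + s) / er bs T (\<lambda>u. x u + s)
        \<le> er (B # bs) T (\<lambda>u. x u + s') / er bs T (\<lambda>u. x u + s')"
      unfolding er_Cons sum_divide_distrib
      by (intro sum_mono er_diag_ratio_mono admissible_insert[OF T] s e)
  qed (use T T' le p in \<open>auto intro: continuous_er_shift eventually_er_pos positive_aboveD\<close>)
  then show "er bs T x > 0" by simp
qed

text \<open>Far out on each diagonal ray the values are positive, so a nonpositive value would force
  a zero in between.\<close>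

lemma positive_above_of_nonzero:
  assumes T: "admissible bs T" and nz: "\<And>x. y \<le> x \<Longrightarrow> er bs T x \<noteq> 0"
  shows "positive_above bs T y"
  unfolding positive_above_def
proof (intro allI impI, rule ccontr)
  fix x assume x: "y \<le> x" and neg: "\<not> er bs T x > 0"
  obtain K where K: "\<And>s. s \<ge> K \<Longrightarrow> er bs T (\<lambda>u. x u + s) > 0"
    using eventually_er_pos[OF T] by (auto simp: eventually_at_top_linorder)
  have "\<exists>s\<ge>0. s \<le> max K 0 \<and> er bs T (\<lambda>u. x u + s) = 0"
    using neg K[of "max K 0"] by (intro IVT' continuous_er_shift[OF T]) auto
  then obtain s where "s \<ge> 0" "er bs T (\<lambda>u. x u + s) = 0" by blast
  moreover have "y \<le> (\<lambda>u. x u + s)" using x \<open>s \<ge> 0\<close> by (auto simp: le_fun_def intro: add_increasing2)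
  ultimately show False using nz by blast
qed

lemma er_ratio_mono_pos:
  assumes T: "admissible bs (insert v T)" "v \<notin> T" and p: "positive_above bs T y" and x: "y \<le> x" "x \<le> x'"
  shows "er bs (insert v T) x / er bs T x \<le> er bs (insert v T) x' / er bs T x'"
  by (rule er_ratio_mono[OF T x(2), where \<sigma> = 1]) (use p x in \<open>auto intro!: positive_aboveD[OF p]\<close>)

text \<open>The interlacing argument: the ratios to \<open>er bs T\<close> increase, so a summand that is positive at
  the corner \<open>y\<close> stays positive above it.\<close>

lemma positive_above_choose:
  assumes T: "admissible (B # bs) T" and p: "positive_above (B # bs) T y"
  shows "\<exists>v\<in>B. positive_above bs (insert v T) y"
proof -
  have q: "positive_above bs T y" by (rule positive_above_pop[OF assms])
  obtain v where v: "v \<in> B" "er bs (insert v T) y > 0"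
    using positive_aboveD[OF p order_refl] unfolding er_Cons by (meson linorder_not_less sum_nonpos)
  have "positive_above bs (insert v T) y" unfolding positive_above_def
  proof (intro allI impI)
    fix x assume x: "y \<le> x"
    have "0 < er bs (insert v T) y / er bs T y" using v positive_aboveD[OF q order_refl] by simp
    also have "\<dots> \<le> er bs (insert v T) x / er bs T x"
      using T v x by (intro er_ratio_mono_pos[OF admissible_insert[OF T v(1)] _ q]) (auto simp: admissible_Cons)
    finally show "er bs (insert v T) x > 0" using positive_aboveD[OF q x] by (simp add: zero_less_divide_iff)
  qed
  with v show ?thesis by blast
qed

lemma positive_above_transversal:
  "admissible bs T \<Longrightarrow> positive_above bs T y \<Longrightarrow>
    \<exists>C. C \<subseteq> \<Union>(set bs) \<and> (\<forall>B\<in>set bs. \<exists>v. B \<inter> C = {v}) \<and> positive_above [] (T \<union> C) y"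
proof (induction bs arbitrary: T)
  case (Cons B bs)
  obtain v where v: "v \<in> B" "positive_above bs (insert v T) y" using positive_above_choose[OF Cons.prems] by blast
  obtain C where C: "C \<subseteq> \<Union>(set bs)" "\<forall>B\<in>set bs. \<exists>v. B \<inter> C = {v}" "positive_above [] (insert v T \<union> C) y"
    using Cons.IH[OF admissible_insert[OF Cons.prems(1) v(1)] v(2)] by blast
  have dis: "B \<inter> \<Union>(set bs) = {}" using Cons.prems by (simp add: admissible_Cons)
  have "B \<inter> insert v C = {v}" using dis C(1) v(1) by blast
  moreover have "B' \<inter> insert v C = B' \<inter> C" if "B' \<in> set bs" for B' using dis v(1) that by blast
  ultimately show ?case using C v by (intro exI[of _ "insert v C"]) auto
qed (auto intro: exI[of _ "{}"])

text \<open>No root in the direction of the block \<open>B\<close> lies below the diagonal entries \<open>a\<close>: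
  the ratios increase to their limit \<open>x v - a v < 0\<close> at infinity.\<close>

lemma er_sign_below:
  assumes T: "admissible bs T" and B: "finite B" "B \<inter> T = {}" "B \<inter> \<Union>(set bs) = {}"
    and diag: "\<And>S x. S \<subseteq> B \<Longrightarrow> er [] S x = (\<Prod>v\<in>S. x v - a v)"
    and p: "positive_above bs T y"
  shows "S \<subseteq> B \<Longrightarrow> (\<And>v. v \<notin> B \<Longrightarrow> y v \<le> x v) \<Longrightarrow> (\<And>v. v \<in> B \<Longrightarrow> x v < a v) \<Longrightarrow>
     (-1) ^ card S * er bs (T \<union> S) x > 0"
proof (induction S arbitrary: x rule: infinite_finite_induct)
  case (infinite S) then show ?case using finite_subset[OF infinite.prems(1) B(1)] by simp
next
  case empty
  have "er bs T x > 0" using B empty.prems by (intro positive_above_cong[OF T p]) auto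
  then show ?case by simp
next
  case (insert v S)
  note x = insert.prems(2,3)
  \<comment> \<open>Only the variables outside \<open>B\<close> are sent to infinity. In the limit
    the ratio depends on the variables of \<open>B\<close> alone, where \<open>diag\<close>
    evaluates it.\<close>
  define s where "s = (\<lambda>t u. if u \<in> - B then x u + t else x u)"
  have v: "v \<in> B" "S \<subseteq> B" "v \<notin> T \<union> S" using insert B by auto
  have admissible: "admissible bs (insert v (T \<union> S))" using T B v finite_subset[of S B] by (auto simp: admissible_def)
  then have admissible': "admissible bs (T \<union> S)" by (rule admissible_subset) auto
  define R where "R = (\<lambda>x. er bs (insert v (T \<union> S)) x / er bs (T \<union> S) x)"
  have mono: "R x \<le> R (s t)" if "t \<ge> 0" for t unfolding R_def
  proof (rule er_ratio_mono[OF admissible v(3), where \<sigma> = "(-1) ^ card S"])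
    fix x' assume x': "x \<le> x'" "x' \<le> s t"
    show "(-1) ^ card S * er bs (T \<union> S) x' > 0"
    proof (rule insert.IH[OF v(2)])
      show "y u \<le> x' u" if "u \<notin> B" for u using x(1)[OF that] x'(1) by (auto simp: le_fun_def intro: order_trans)
      show "x' u < a u" if "u \<in> B" for u using x(2)[OF that] x'(2) that
        by (auto simp: le_fun_def s_def dest!: spec[of _ u])
    qed
  qed (use that in \<open>auto simp: le_fun_def s_def\<close>)
  have "((\<lambda>t. R (s t)) \<longlongrightarrow> x v - a v) at_top"
  proof -
    let ?K = "\<Prod>B\<leftarrow>bs. real (card B)"
    let ?n = "card (T \<inter> - B) + length bs"
    have eqs: "insert v (T \<union> S) \<inter> - B = T \<inter> - B" "(T \<union> S) \<inter> - B = T \<inter> - B"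
       "insert v (T \<union> S) - (- B) = insert v S" "(T \<union> S) - (- B) = S" using B v by auto
    have sub: "\<Union>(set bs) \<subseteq> - B" using B by auto
    have l1: "((\<lambda>t. er bs (insert v (T \<union> S)) (s t) / t ^ ?n) \<longlongrightarrow> ?K * er [] (insert v S) x) at_top"
      using er_limit[OF admissible sub, of x] unfolding eqs s_def .
    have l2: "((\<lambda>t. er bs (T \<union> S) (s t) / t ^ ?n) \<longlongrightarrow> ?K * er [] S x) at_top"
      using er_limit[OF admissible' sub, of x] unfolding eqs s_def .
    have "x u - a u \<noteq> 0" if "u \<in> S" for u using x(2)[of u] that v(2) by auto
    then have nz: "er [] S x \<noteq> 0" "?K \<noteq> 0"
      using v(2) insert.hyps(1) card_prod_pos[OF T] by (simp_all add: diag)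
    have lim: "((\<lambda>t. (er bs (insert v (T \<union> S)) (s t) / t ^ ?n) / (er bs (T \<union> S) (s t) / t ^ ?n))
        \<longlongrightarrow> (?K * er [] (insert v S) x) / (?K * er [] S x)) at_top"
      using l1 l2 nz by (intro tendsto_divide) auto
    have eq: "(?K * er [] (insert v S) x) / (?K * er [] S x) = x v - a v"
      using nz v insert.hyps by (simp add: diag)
    have ev: "eventually (\<lambda>t. (er bs (insert v (T \<union> S)) (s t) / t ^ ?n) / (er bs (T \<union> S) (s t) / t ^ ?n) = R (s t)) at_top"
      using eventually_gt_at_top[of 0] by eventually_elim (simp add: R_def)
    show ?thesis using lim unfolding eq tendsto_cong[OF ev] .
  qed
  then have "R x \<le> x v - a v"
    by (rule tendsto_lowerbound) (auto intro!: eventually_mono[OF eventually_ge_at_top[of 0]] mono)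
  then have neg: "R x < 0" using x(2)[OF v(1)] by simp
  have pS: "(-1) ^ card S * er bs (T \<union> S) x > 0" by (rule insert.IH[OF v(2) x])
  then have "er bs (insert v (T \<union> S)) x = R x * er bs (T \<union> S) x" by (auto simp: R_def)
  then have "(-1) ^ card (insert v S) * er bs (T \<union> insert v S) x = - R x * ((-1) ^ card S * er bs (T \<union> S) x)"
    using insert.hyps by simp
  also have "\<dots> > 0" using neg by (intro mult_pos_pos[OF _ pS]) simp
  finally show ?case .
qed

subsection \<open>The barrier argument\<close>

text \<open>The restriction of \<open>er bs T\<close> to the line through \<open>y\<close> along the
  indicator of \<open>B\<close>, as a polynomial in the shift. Its coefficients are given by
  deletions of subsets of \<open>B\<close>, which is how derivatives in several variables of a block
  become accessible.\<close>

definition section_poly :: "'v set list \<Rightarrow> 'v set \<Rightarrow> 'v set \<Rightarrow> ('v \<Rightarrow> real) \<Rightarrow> real poly" where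
  "section_poly bs T B y = (\<Sum>S\<in>Pow B. monom (er bs (T - S) y) (card S))"

lemma cpoly_section_poly:
  assumes T: "admissible bs T" "B \<subseteq> T"
  shows "cpoly (section_poly bs T B y) u = E bs T (\<lambda>v. if v \<in> B then of_real (y v) + u else of_real (y v))"
proof -
  have fin: "finite B" using T admissible_finite finite_subset by blast
  have "E bs T (\<lambda>v. if v \<in> B then of_real (y v) + u else of_real (y v))
     = (\<Sum>S\<in>Pow B. u ^ card S * E bs (T - S) (\<lambda>v. of_real (y v)))"
    by (rule E_shift[OF fin T])
  also have "\<dots> = (\<Sum>S\<in>Pow B. u ^ card S * of_real (er bs (T - S) y))"
    using T by (intro sum.cong refl arg_cong2[of _ _ _ _ "(*)"] E_real) (auto intro: admissible_subset)
  finally show ?thesis by (simp add: section_poly_def cpoly_sum cpoly_monom mult.commute)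
qed

lemma poly_section_poly:
  assumes T: "admissible bs T" "B \<subseteq> T"
  shows "poly (section_poly bs T B y) s = er bs T (\<lambda>v. if v \<in> B then y v + s else y v)"
  using er_shift[OF T, of y s] by (simp add: section_poly_def poly_sum poly_monom mult.commute)

lemma poly_section_poly_0: "admissible bs T \<Longrightarrow> B \<subseteq> T \<Longrightarrow> poly (section_poly bs T B y) 0 = er bs T y"
  unfolding poly_section_poly by (rule er_cong) auto

lemma degree_section_poly: "finite B \<Longrightarrow> degree (section_poly bs T B y) \<le> card B"
  unfolding section_poly_def
  by (intro degree_sum_le order_trans[OF degree_monom_le]) (auto intro: card_mono)

text \<open>The variables outside \<open>B\<close> stay real here, so \<open>E_nz\<close> does not
  apply. Instead the variables of \<open>B\<close> are added one by one to \<open>T - B\<close>,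
  where the value is real and positive; each addition keeps it nonzero because Im u > 0.\<close>

lemma section_poly_nonzero:
  assumes T: "admissible bs T" "B \<subseteq> T" and p: "positive_above bs T y" and u: "Im u > 0"
  shows "cpoly (section_poly bs T B y) u \<noteq> 0"
proof -
  have fin: "finite B" using T admissible_finite finite_subset by blast
  define z where "z = (\<lambda>v. if v \<in> B then of_real (y v) + u else of_real (y v))"
  have "E bs (T - B \<union> S) z \<noteq> 0" if "finite S" "S \<subseteq> B" for S using that
  proof (induction S)
    case empty
    have admissible: "admissible bs (T - B)" using T by (auto intro: admissible_subset)
    have "v \<notin> B" if "v \<in> T - B \<union> \<Union>(set bs)" for v
      using that admissible_notin[OF T(1), of v] T(2) by auto
    then have "E bs (T - B) z = E bs (T - B) (\<lambda>v. of_real (y v))"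
      by (intro E_cong[OF admissible]) (auto simp: z_def)
    also have "\<dots> = of_real (er bs (T - B) y)" by (rule E_real[OF admissible])
    finally show ?case using positive_aboveD[OF positive_above_subset[OF T(1) _ p, of "T - B"] order_refl] by auto
  next
    case (insert v S)
    have admissible: "admissible bs (insert v (T - B \<union> S))"
      by (rule admissible_subset[OF T(1)]) (use insert T in auto)
    have eq: "insert v (T - B \<union> S) - {v} = T - B \<union> S" using insert by auto
    have "0 < Im (z v) * (cmod (E bs (T - B \<union> S) z))\<^sup>2"
      using insert u by (auto simp: z_def)
    also have "\<dots> \<le> Im (E bs (insert v (T - B \<union> S)) z * cnj (E bs (T - B \<union> S) z))"
      using Im_E_mult_cnj[OF admissible insertI1, of z] u unfolding eq by (auto simp: z_def)
    finally have "E bs (insert v (T - B \<union> S)) z \<noteq> 0" by auto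
    then show ?case by simp
  qed
  from this[OF fin order_refl] show ?thesis
    using T by (simp add: cpoly_section_poly[OF T] z_def Un_absorb2)
qed

text \<open>All roots are real: there are none in the open upper half-plane, and conjugation
  excludes the lower one. They lie below 0 because \<open>y\<close> is above the roots.\<close>

lemma section_poly_factor:
  assumes T: "admissible bs T" "B \<subseteq> T" and p: "positive_above bs T y"
    and diag: "\<And>S x. S \<subseteq> B \<Longrightarrow> er [] S x = (\<Prod>v\<in>S. x v - a v)"
    and a: "\<And>v. v \<in> B \<Longrightarrow> a v \<ge> 0" and b: "\<And>v. v \<in> B \<Longrightarrow> y v = b"
  obtains ds where "length ds = card B" "\<And>d. d \<in> set ds \<Longrightarrow> 0 < d \<and> d \<le> b"
    "section_poly bs T B y = smult (er bs (T - B) y) (root_poly ds)"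
proof -
  have fin: "finite B" using T admissible_finite finite_subset by blast
  define q where "q = section_poly bs T B y"
  define c where "c = er bs (T - B) y"
  have c: "c > 0" unfolding c_def using positive_aboveD[OF positive_above_subset[OF T(1) _ p, of "T - B"] order_refl] by auto
  have coeff: "coeff q (card B) = c"
    unfolding q_def section_poly_def c_def by (rule coeff_sum_monom_card_top[OF fin])
  have deg: "degree q = card B"
    using degree_section_poly[OF fin, of bs T y] coeff c le_degree[of q "card B"] by (simp add: q_def)
  define cq where "cq = map_poly complex_of_real q"
  have degc: "degree cq = card B" by (simp add: cq_def deg degree_map_poly)
  have "cq \<noteq> 0" using c coeff by (auto simp: cq_def map_poly_eq_0_iff)
  then obtain A where A: "size A = degree cq" "cq = smult (lead_coeff cq) (\<Prod>x\<in>#A. [:-x, 1:])"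
    using alg_closed_imp_factorization by blast
  obtain xs where xs: "mset xs = A" using ex_mset by blast
  have lead: "lead_coeff cq = of_real c" using coeff degc by (simp add: cq_def coeff_map_poly)
  have cq: "cq = smult (of_real c) (\<Prod>x\<leftarrow>xs. [:-x, 1:])"
    using A(2) unfolding lead xs[symmetric] by (simp add: prod_mset_prod_list flip: mset_map)
  have len: "length xs = card B" using A(1) degc by (simp flip: xs)
  have root: "cpoly q x = 0" if "x \<in> set xs" for x
  proof -
    have "poly (\<Prod>x\<leftarrow>xs. [:-x, 1:]) x = 0" using that by (induction xs) auto
    then show ?thesis by (simp add: cpoly_def cq_def[symmetric] cq)
  qed
  have real: "Im x = 0" if "x \<in> set xs" for x
  proof -
    have cnj: "cpoly q (cnj u) = cnj (cpoly q u)" for u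
      by (induction q) auto
    have "\<not> Im x > 0" using root[OF that] section_poly_nonzero[OF T p, of x] by (auto simp: q_def)
    moreover have "\<not> Im (cnj x) > 0"
      using root[OF that] section_poly_nonzero[OF T p, of "cnj x"] cnj[of x] by (auto simp: q_def)
    ultimately show ?thesis by simp
  qed
  define ds where "ds = map (\<lambda>x. - Re x) xs"
  have qq: "q = smult c (root_poly ds)"
  proof -
    have "poly q t = poly (smult c (root_poly ds)) t" for t
    proof -
      have "complex_of_real (poly q t) = of_real c * poly (\<Prod>x\<leftarrow>xs. [:-x, 1:]) (of_real t)"
        using cpoly_of_real[of q t] by (simp add: cpoly_def cq_def[symmetric] cq)
      also have "poly (\<Prod>x\<leftarrow>xs. [:-x, 1:]) (of_real t) = of_real (poly (root_poly ds) t)"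
        unfolding ds_def using real
      proof (induction xs)
        case (Cons x xs)
        have "x = of_real (Re x)" using Cons.prems[of x] by (simp add: complex_eq_iff)
        then have "poly [:-x, 1:] (of_real t) = of_real (poly [:- Re x, 1:] t)" by (simp add: complex_eq_iff)
        with Cons show ?case by (simp add: poly_mult del: poly_pCons mult_pCons_left)
      qed simp
      finally show ?thesis by (metis of_real_eq_iff of_real_mult poly_smult)
    qed
    then show ?thesis using poly_eq_poly_eq_iff by blast
  qed
  have bounds: "0 < d \<and> d \<le> b" if d: "d \<in> set ds" for d
  proof -
    have "poly q (-d) = 0" using d poly_root_poly_eq_0_iff[of ds "-d"] by (simp add: qq)
    then have z: "er bs T (\<lambda>v. if v \<in> B then y v + - d else y v) = 0"
      unfolding q_def poly_section_poly[OF T] .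
    have "0 < d"
    proof (rule ccontr)
      assume "\<not> 0 < d"
      then have "y \<le> (\<lambda>v. if v \<in> B then y v + - d else y v)" by (auto simp: le_fun_def)
      from positive_aboveD[OF p this] z show False by simp
    qed
    \<comment> \<open>For d > b the shift puts every variable of \<open>B\<close> at b - d < 0 \<le>
      a v, a region that \<open>er_sign_below\<close> shows to be free of zeros.\<close>
    moreover have "d \<le> b"
    proof (rule ccontr)
      assume db: "\<not> d \<le> b"
      have "(-1) ^ card B * er bs (T - B \<union> B) (\<lambda>v. if v \<in> B then y v + - d else y v) > 0"
      proof (rule er_sign_below[where bs = bs and T = "T - B" and a = a and y = y])
        show "admissible bs (T - B)" using T by (auto intro: admissible_subset)
        show "positive_above bs (T - B) y" by (rule positive_above_subset[OF T(1) _ p]) auto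
        show "B \<inter> \<Union>(set bs) = {}" using T admissible_notin by fastforce
        show "(if v \<in> B then y v + - d else y v) < a v" if "v \<in> B" for v
          using that db b[OF that] a[OF that] by simp
      qed (use fin diag in auto)
      moreover have "T - B \<union> B = T" using T by auto
      ultimately show False using z by simp
    qed
    ultimately show ?thesis by simp
  qed
  show ?thesis
    by (rule that[of ds]) (use bounds qq len in \<open>auto simp: ds_def q_def c_def\<close>)
qed

text \<open>The logarithmic derivative of \<open>er bs T\<close> at \<open>y\<close> along the block \<open>L\<close>.\<close>

definition barrier :: "'v set list \<Rightarrow> 'v set \<Rightarrow> ('v \<Rightarrow> real) \<Rightarrow> 'v set \<Rightarrow> real" where
  "barrier bs T y L = (\<Sum>v\<in>L. er bs (T - {v}) y) / er bs T y"

lemma er_shift_one: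
  assumes T: "admissible bs T" and w: "w \<in> B" "B \<inter> T = {}" "B \<inter> \<Union>(set bs) = {}"
  shows "er bs (insert w T) (\<lambda>v. if v \<in> B then y v - \<delta> else y v) = er bs (insert w T) y - \<delta> * er bs T y"
proof -
  have admissible: "admissible bs (insert w T)" using assms by (auto simp: admissible_def)
  have "er bs (insert w T) (\<lambda>v. if v \<in> B then y v - \<delta> else y v) = er bs (insert w T) (y(w := y w - \<delta>))"
    using w by (intro er_cong[OF admissible]) auto
  also have "\<dots> = er bs (insert w T) y - \<delta> * er bs (insert w T - {w}) y"
    by (simp add: er_upd[OF admissible insertI1])
  finally show ?thesis using w by (simp add: insert_Diff_if Diff_insert0 disjoint_iff)
qed

text \<open>If \<open>-d\<^sub>1, \<dots>, -d\<^sub>r\<close> are the roots along \<open>B\<close>, any shift \<open>\<delta>\<close> with \<open>d\<^sub>k \<le> (\<Sum>d) - r \<delta>\<close> for all \<open>k\<close> is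
  admissible for the barriers. As \<open>d\<^sub>k \<le> b\<close>, the other reciprocals sum to at most \<open>\<phi> - 1 / b\<close>, and the
  inequality between the arithmetic and the harmonic mean yields this value of \<open>\<delta>\<close>.\<close>

lemma barrier_step:
  fixes \<delta> b \<phi> :: real and B :: "'v set"
  defines "\<delta> \<equiv> (real (card B) - 1)\<^sup>2 / (real (card B) * (\<phi> - 1 / b))"
  assumes T: "admissible bs T" "B \<subseteq> T" and r: "card B \<ge> 2" and p: "positive_above bs T y"
    and diag: "\<And>S x. S \<subseteq> B \<Longrightarrow> er [] S x = (\<Prod>v\<in>S. x v - a v)"
    and a: "\<And>v. v \<in> B \<Longrightarrow> a v \<ge> 0" and b: "\<And>v. v \<in> B \<Longrightarrow> y v = b" "b > 0"
    and \<phi>: "barrier bs T y B \<le> \<phi>" "1 / b < \<phi>"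
  defines "y' \<equiv> \<lambda>v. if v \<in> B then y v - \<delta> else y v"
  shows "positive_above (B # bs) (T - B) y'"
    and "\<And>L. L \<subseteq> T - B \<Longrightarrow> barrier (B # bs) (T - B) y' L \<le> barrier bs T y L"
proof -
  let ?r = "card B"
  have fin: "finite B" using T admissible_finite finite_subset by blast
  have ne: "B \<noteq> {}" using r by auto
  have adm0: "admissible bs (T - B)" using T by (auto intro: admissible_subset)
  have dis: "B \<inter> \<Union>(set bs) = {}" using T admissible_notin by fastforce
  have admB: "admissible (B # bs) (T - B)" using fin ne dis adm0 by (auto simp: admissible_Cons)
  define c where "c = er bs (T - B) y"
  have p0: "positive_above bs (T - B) y" by (rule positive_above_subset[OF T(1) _ p]) auto
  have c: "c > 0" unfolding c_def using positive_aboveD[OF p0 order_refl] .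
  obtain ds where ds: "length ds = ?r" "\<And>d. d \<in> set ds \<Longrightarrow> 0 < d \<and> d \<le> b"
    "section_poly bs T B y = smult c (root_poly ds)"
    using section_poly_factor[OF T p diag a b(1)] unfolding c_def by metis
  have q0: "er bs T y = c * prod_list ds"
    using poly_section_poly_0[OF T, of y] ds(3) by (simp add: poly_root_poly_0)
  have P: "prod_list ds > 0" using q0 positive_aboveD[OF p order_refl] c by (simp add: zero_less_mult_iff)
  have q1: "barrier bs T y B = sum_list (map inverse ds)"
  proof -
    have "(\<Sum>v\<in>B. er bs (T - {v}) y) = coeff (section_poly bs T B y) 1"
      unfolding section_poly_def by (rule coeff_sum_monom_card_one[OF fin, symmetric])
    also have "\<dots> = c * (prod_list ds * sum_list (map inverse ds))"
      unfolding ds(3) coeff_smult using ds(2) by (subst coeff_root_poly_1) force+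
    finally show ?thesis using c P by (simp add: barrier_def q0)
  qed
  have qr: "(\<Sum>w\<in>B. er bs (insert w (T - B)) y) = c * sum_list ds"
  proof -
    have "T - (B - {w}) = insert w (T - B)" if "w \<in> B" for w using that T by auto
    then have "(\<Sum>w\<in>B. er bs (insert w (T - B)) y) = coeff (section_poly bs T B y) (?r - 1)"
      unfolding section_poly_def coeff_sum_monom_card_sub[OF fin ne] by simp
    also have "\<dots> = coeff (pCons 0 (smult c (root_poly ds))) ?r"
      using r unfolding ds(3) by (auto simp: coeff_pCons split: nat.splits)
    also have "\<dots> = c * sum_list ds"
      using subleading_coeff_root_poly[of ds] ds(1) by (auto simp: coeff_pCons split: nat.splits)
    finally show ?thesis .
  qed
  \<comment> \<open>c M will be the value of the new function at the shifted point: the sum over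
    \<open>B\<close> gives c times the sum of the distances, and each of its r summands loses
    \<delta> c.\<close>
  define M where "M = sum_list ds - real ?r * \<delta>"
  have M: "d \<le> M" if d: "d \<in> set ds" for d
  proof -
    define ds' where "ds' = remove1 d ds"
    have len: "real (length ds') = real ?r - 1"
      using d ds(1) r by (simp add: ds'_def length_remove1 of_nat_diff)
    have "sum_list (map inverse ds) = inverse d + sum_list (map inverse ds')"
      using d unfolding ds'_def by (induction ds) auto
    moreover have "1 / b \<le> inverse d" using ds(2)[OF d] by (simp add: field_simps)
    ultimately have I: "sum_list (map inverse ds') \<le> \<phi> - 1 / b" using \<phi>(1) q1 by simp
    \<comment> \<open>The maximiser of 2 t (r - 1) - t^2 (\<phi> - 1 / b). The maximum is r
      \<delta>, which is where the formula for \<delta> comes from.\<close>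
    define t where "t = (real ?r - 1) / (\<phi> - 1 / b)"
    have "real ?r * \<delta> = 2 * t * (real ?r - 1) - t\<^sup>2 * (\<phi> - 1 / b)"
    proof -
      have "R * ((R - 1)\<^sup>2 / (R * K)) = 2 * ((R - 1) / K) * (R - 1) - ((R - 1) / K)\<^sup>2 * K"
        if "R > 0" "K > 0" for R K :: real
        using that by (simp add: power2_eq_square field_simps)
      from this[of "real ?r" "\<phi> - 1 / b"] show ?thesis
        using \<phi>(2) r unfolding \<delta>_def t_def by simp
    qed
    also have "\<dots> \<le> 2 * t * real (length ds') - t\<^sup>2 * sum_list (map inverse ds')"
      unfolding len by (intro diff_left_mono mult_left_mono I) simp
    also have "\<dots> \<le> sum_list ds'"
      using ds(2) set_remove1_subset[of d ds] by (intro sum_list_ge_harmonic) (auto simp: ds'_def)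
    finally show ?thesis using sum_list_remove1[OF d] by (simp add: M_def ds'_def)
  qed
  obtain d0 where "d0 \<in> set ds" using ds(1) r by (cases ds) auto
  then have Mpos: "M > 0" using M ds(2) by force
  have y'0: "er bs X y' = er bs X y" if "X \<subseteq> T - B" for X
    using that dis admissible_subset[OF adm0 that] by (intro er_cong) (auto simp: y'_def)
  have y'1: "er bs (insert w X) y' = er bs (insert w X) y - \<delta> * er bs X y" if "w \<in> B" "X \<subseteq> T - B" for w X
    unfolding y'_def using that dis admissible_subset[OF adm0 that(2)] by (intro er_shift_one) auto
  have new: "er (B # bs) (T - B) y' = c * M"
  proof -
    have "er (B # bs) (T - B) y' = (\<Sum>w\<in>B. er bs (insert w (T - B)) y - \<delta> * c)"
      unfolding er_Cons c_def by (intro sum.cong refl y'1) auto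
    also have "\<dots> = c * sum_list ds - real ?r * (\<delta> * c)" by (simp add: sum_subtractf qr)
    finally show ?thesis by (simp add: M_def algebra_simps)
  qed
  have p0': "positive_above bs (T - B) y'"
    unfolding positive_above_def
  proof (intro allI impI)
    fix x assume "y' \<le> x"
    then have "y v \<le> x v" if "v \<in> T - B \<union> \<Union>(set bs)" for v
      using that dis by (auto simp: le_fun_def y'_def dest!: spec[of _ v] split: if_splits)
    then show "er bs (T - B) x > 0" by (rule positive_above_cong[OF adm0 p0])
  qed
  show "positive_above (B # bs) (T - B) y'" unfolding positive_above_def
  proof (intro allI impI)
    fix x assume x: "y' \<le> x"
    \<comment> \<open>Positivity at the corner \<open>y'\<close> spreads over the orthant because
      the summands divided by \<open>er bs (T - B)\<close> increase.\<close>
    have "0 < er (B # bs) (T - B) y' / er bs (T - B) y'"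
      using new c Mpos positive_aboveD[OF p0' order_refl] by simp
    also have "\<dots> \<le> er (B # bs) (T - B) x / er bs (T - B) x"
      unfolding er_Cons sum_divide_distrib
      by (intro sum_mono er_ratio_mono_pos[OF admissible_insert[OF admB] _ p0' order_refl x]) auto
    finally show "er (B # bs) (T - B) x > 0" using positive_aboveD[OF p0' x] by (simp add: zero_less_divide_iff)
  qed
  fix L assume L: "L \<subseteq> T - B"
  \<comment> \<open>h is the derivative along \<open>L\<close> on the line in direction
    \<open>B\<close>. Its value at 0 is the numerator of the old barrier, and its two top
    coefficients give the numerator of the new one.\<close>
  define h where "h = (\<Sum>v\<in>L. section_poly bs (T - {v}) B y)"
  have Lsub: "admissible bs (T - {v})" "B \<subseteq> T - {v}" "T - {v} - B = T - B - {v}" if "v \<in> L" for v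
    using that L T by (auto intro: admissible_subset)
  have finL: "finite L" using L T admissible_finite finite_subset by blast
  have h0: "poly h 0 = (\<Sum>v\<in>L. er bs (T - {v}) y)"
    unfolding h_def poly_sum by (intro sum.cong refl poly_section_poly_0 Lsub)
  have hr: "coeff h ?r = (\<Sum>v\<in>L. er bs (T - B - {v}) y)"
    unfolding h_def coeff_sum[of _ L] section_poly_def coeff_sum_monom_card_top[OF fin] by (simp add: Lsub)
  have hr1: "coeff (pCons 0 h) ?r = (\<Sum>v\<in>L. \<Sum>w\<in>B. er bs (insert w (T - B - {v})) y)"
  proof -
    have "coeff (pCons 0 h) ?r = coeff h (?r - 1)"
      using r by (auto simp: coeff_pCons split: nat.splits)
    moreover have "T - {v} - (B - {w}) = insert w (T - B - {v})" if "v \<in> L" "w \<in> B" for v w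
      using that L T by auto
    ultimately show ?thesis
      unfolding h_def coeff_sum[of _ L] section_poly_def coeff_sum_monom_card_sub[OF fin ne] by simp
  qed
  \<comment> \<open>Since M minus the sum of the distances is - r \<delta>, the left factor is the
    new numerator. Division by c M and by the product of the distances turns the inequality into the
    comparison of the barriers.\<close>
  have "(coeff (pCons 0 h) (length ds) + (M - sum_list ds) * coeff h (length ds)) * prod_list ds \<le> M * poly h 0"
  proof (rule interlacing_coeff_bound)
    show "0 < d \<and> d \<le> M" if "d \<in> set ds" for d using M[OF that] ds(2)[OF that] by simp
    show "degree h \<le> length ds"
      unfolding h_def ds(1) using finL by (intro degree_sum_le degree_section_poly[OF fin]) auto
    fix u :: complex assume u: "Im u > 0"
    let ?z = "\<lambda>v. if v \<in> B then of_real (y v) + u else of_real (y v)"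
    have "0 \<le> (\<Sum>v\<in>L. Im (E bs T ?z * cnj (E bs (T - {v}) ?z)))"
    proof (rule sum_nonneg)
      fix v assume v: "v \<in> L"
      have z: "Im (?z w) \<ge> 0" for w using u by simp
      have "0 \<le> Im (?z v) * (cmod (E bs (T - {v}) ?z))\<^sup>2" using z[of v] by (intro mult_nonneg_nonneg) auto
      also have "\<dots> \<le> Im (E bs T ?z * cnj (E bs (T - {v}) ?z))"
        using v L by (intro Im_E_mult_cnj[OF T(1) _ z]) auto
      finally show "0 \<le> Im (E bs T ?z * cnj (E bs (T - {v}) ?z))" .
    qed
    also have "\<dots> = Im (cpoly (smult c (root_poly ds)) u * cnj (cpoly h u))"
      unfolding ds(3)[symmetric] h_def cpoly_sum cpoly_section_poly[OF T]
      by (simp add: cpoly_section_poly[OF Lsub(1,2)] cnj_sum sum_distrib_left Im_sum)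
    also have "\<dots> = c * Im (cpoly (root_poly ds) u * cnj (cpoly h u))"
      by (simp add: cpoly_smult algebra_simps)
    finally show "0 \<le> Im (cpoly (root_poly ds) u * cnj (cpoly h u))" using c by (simp add: zero_le_mult_iff)
  qed
  then have main: "(coeff (pCons 0 h) ?r - real ?r * \<delta> * coeff h ?r) * prod_list ds \<le> M * poly h 0"
    by (simp add: ds(1) M_def)
  have num: "(\<Sum>v\<in>L. er (B # bs) (T - B - {v}) y') = coeff (pCons 0 h) ?r - real ?r * \<delta> * coeff h ?r"
  proof -
    have "(\<Sum>v\<in>L. er (B # bs) (T - B - {v}) y')
        = (\<Sum>v\<in>L. \<Sum>w\<in>B. er bs (insert w (T - B - {v})) y - \<delta> * er bs (T - B - {v}) y)"
      unfolding er_Cons by (intro sum.cong refl y'1) auto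
    also have "\<dots> = coeff (pCons 0 h) ?r - real ?r * \<delta> * coeff h ?r"
      unfolding hr hr1 by (simp add: sum_subtractf sum_distrib_left mult.assoc)
    finally show ?thesis .
  qed
  have "barrier (B # bs) (T - B) y' L = (coeff (pCons 0 h) ?r - real ?r * \<delta> * coeff h ?r) / (c * M)"
    by (simp add: barrier_def num new)
  also have "\<dots> \<le> poly h 0 / (c * prod_list ds)"
  proof -
    have "(coeff (pCons 0 h) ?r - real ?r * \<delta> * coeff h ?r) / M \<le> poly h 0 / prod_list ds"
      using main Mpos P by (simp add: divide_le_eq le_divide_eq mult_ac)
    from divide_right_mono[OF this, of c] show ?thesis using c by (simp add: mult.commute)
  qed
  also have "\<dots> = barrier bs T y L" by (simp add: barrier_def h0 q0)
  finally show "barrier (B # bs) (T - B) y' L \<le> barrier bs T y L" .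
qed

text \<open>Treating one block leaves the variables of the others at \<open>b\<close> and their
  barriers at most \<phi>, so the same \<delta> serves at every step.\<close>

lemma barrier_iterate:
  fixes \<delta> b \<phi> :: real and r :: nat
  defines "\<delta> \<equiv> (real r - 1)\<^sup>2 / (real r * (\<phi> - 1 / b))"
  assumes "b > 0" "1 / b < \<phi>" "r \<ge> 2"
  shows "\<lbrakk>admissible bs (\<Union>(set cs)); sorted_wrt disjnt cs; positive_above bs (\<Union>(set cs)) y;
      \<And>C. C \<in> set cs \<Longrightarrow> card C = r; \<And>C. C \<in> set cs \<Longrightarrow> barrier bs (\<Union>(set cs)) y C \<le> \<phi>;
      \<And>C v. C \<in> set cs \<Longrightarrow> v \<in> C \<Longrightarrow> y v = b;
      \<And>C S x. C \<in> set cs \<Longrightarrow> S \<subseteq> C \<Longrightarrow> er [] S x = (\<Prod>v\<in>S. x v - a v); \<And>v. a v \<ge> 0\<rbrakk>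
    \<Longrightarrow> positive_above (rev cs @ bs) {} (\<lambda>v. if v \<in> \<Union>(set cs) then y v - \<delta> else y v)"
proof (induction cs arbitrary: bs y)
  case (Cons C cs)
  let ?T = "\<Union>(set (C # cs))"
  let ?y = "\<lambda>v. if v \<in> C then y v - \<delta> else y v"
  note prems = Cons.prems
  have dis: "C \<inter> \<Union>(set cs) = {}" using prems(2) by (auto simp: disjnt_def)
  then have eq: "?T - C = \<Union>(set cs)" by auto
  have card: "card C = r" using prems(4) by simp
  have step: "positive_above (C # bs) (?T - C) ?y"
      "\<And>L. L \<subseteq> ?T - C \<Longrightarrow> barrier (C # bs) (?T - C) ?y L \<le> barrier bs ?T y L"
  proof -
    have C: "C \<in> set (C # cs)" "C \<subseteq> ?T" "2 \<le> card C" using card assms(4) by auto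
    note step = barrier_step[OF prems(1) C(2,3) prems(3) prems(7)[OF C(1)] prems(8) prems(6)[OF C(1)]
        assms(2) prems(5)[OF C(1)] assms(3), unfolded card, folded \<delta>_def]
    show "positive_above (C # bs) (?T - C) ?y" by (rule step(1))
    show "barrier (C # bs) (?T - C) ?y L \<le> barrier bs ?T y L" if "L \<subseteq> ?T - C" for L
      by (rule step(2)[OF _ _ that])
  qed
  have "positive_above (rev cs @ (C # bs)) {} (\<lambda>v. if v \<in> \<Union>(set cs) then ?y v - \<delta> else ?y v)"
  proof (rule Cons.IH)
    have "finite C" "C \<noteq> {}" using card assms(4) card.infinite[of C] by fastforce+
    moreover have "C \<inter> \<Union>(set bs) = {}" using prems(1) by (auto simp: admissible_def)
    ultimately show "admissible (C # bs) (\<Union>(set cs))"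
      using dis prems(1) by (auto simp: admissible_Cons intro: admissible_subset)
    show "positive_above (C # bs) (\<Union>(set cs)) ?y" using step(1) unfolding eq .
    show "barrier (C # bs) (\<Union>(set cs)) ?y D \<le> \<phi>" if "D \<in> set cs" for D
      using step(2)[of D] prems(5)[of D] that unfolding eq by force
    show "?y v = b" if "D \<in> set cs" "v \<in> D" for D v
      using that prems(6)[of D v] dis by auto
    show "er [] S x = (\<Prod>v\<in>S. x v - a v)" if "D \<in> set cs" "S \<subseteq> D" for D S x
      using that by (intro prems(7)[of D]) auto
  qed (use prems in auto)
  moreover have "(\<lambda>v. if v \<in> \<Union>(set cs) then ?y v - \<delta> else ?y v) = (\<lambda>v. if v \<in> ?T then y v - \<delta> else y v)"
    using dis by (auto simp: fun_eq_iff)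
  ultimately show ?case by simp
qed simp

end

section \<open>Hermitian matrices\<close>

text \<open>The inner product on complex vectors is the real part of the Hermitian one. For
  Hermitian matrices this loses nothing, as their quadratic forms are real.\<close>

lemma inner_complex_vec: "(x::complex^'n) \<bullet> y = Re (\<Sum>k\<in>UNIV. cnj (x $ k) * y $ k)"
  by (simp add: inner_vec_def inner_complex_def)

lemma hermitian_adjoint:
  assumes "hermitian_matrix A"
  shows "(A *v x) \<bullet> y = x \<bullet> (A *v y)"
proof -
  have A: "cnj (A $ i $ j) = A $ j $ i" for i j
    using assms by (auto simp: hermitian_matrix_def conj_transpose_def vec_eq_iff)
  have "(\<Sum>k\<in>UNIV. cnj ((A *v x) $ k) * y $ k) = (\<Sum>k\<in>UNIV. \<Sum>j\<in>UNIV. A $ j $ k * cnj (x $ j) * y $ k)"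
    by (simp add: matrix_vector_mult_def sum_distrib_right A)
  also have "\<dots> = (\<Sum>j\<in>UNIV. \<Sum>k\<in>UNIV. A $ j $ k * cnj (x $ j) * y $ k)"
    by (rule sum.swap)
  also have "\<dots> = (\<Sum>j\<in>UNIV. cnj (x $ j) * (A *v y) $ j)"
    by (simp add: matrix_vector_mult_def sum_distrib_left mult_ac)
  finally show ?thesis by (simp add: inner_complex_vec)
qed

lemma matrix_vector_mult_scaleR: "(A::complex^'n^'m) *v (c *\<^sub>R x) = c *\<^sub>R (A *v x)"
  by (simp add: linear_scale)

lemma of_real_smult_vec: "complex_of_real c *s x = c *\<^sub>R x"
  unfolding vec_eq_iff vector_smult_component vector_scaleR_component by (simp add: scaleR_conv_of_real)

text \<open>First-order optimality at a maximiser: at t = - a / K with K > |c| the linear term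
  dominates the quadratic one.\<close>

lemma linear_term_zero:
  fixes a c :: real
  assumes "\<And>t. 2 * t * a + t\<^sup>2 * c \<ge> 0"
  shows "a = 0"
proof (rule ccontr)
  assume a: "a \<noteq> 0"
  define K where "K = \<bar>c\<bar> + 1"
  have K: "K > 0" "c < K" by (auto simp: K_def)
  have "2 * (- a / K) * a + (- a / K)\<^sup>2 * c = (a\<^sup>2 / K\<^sup>2) * (c - 2 * K)"
    using K by (simp add: power2_eq_square field_simps)
  also have "\<dots> < 0" using a K by (intro mult_pos_neg) auto
  finally show False using assms[of "- a / K"] by simp
qed

text \<open>The quadratic form attains a maximum m on the unit sphere. Varying the maximiser v in
  the direction of the residual m v - B v has first-order term the squared norm of that residual,
  which must therefore vanish.\<close>

lemma hermitian_max_eigenvalue: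
  fixes B :: "complex^'n^'n"
  assumes B: "hermitian_matrix B"
  obtains m v where "v \<noteq> 0" "B *v v = m *\<^sub>R v" "\<And>w. w \<bullet> (B *v w) \<le> m * (w \<bullet> w)"
proof -
  let ?q = "\<lambda>w. w \<bullet> (B *v w)"
  have "sphere 0 1 \<noteq> ({} :: (complex^'n) set)" by simp
  moreover have "continuous_on (sphere 0 1) ?q"
    by (intro continuous_intros linear_continuous_on linear_linear[THEN iffD1]) auto
  ultimately obtain v where v: "v \<in> sphere 0 1" and max: "\<And>w. w \<in> sphere 0 1 \<Longrightarrow> ?q w \<le> ?q v"
    using continuous_attains_sup[of "sphere 0 1" ?q] compact_sphere by blast
  define m where "m = ?q v"
  have nv: "norm v = 1" using v by simp
  then have v1: "v \<bullet> v = 1" by (simp add: dot_square_norm)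
  have le: "?q w \<le> m * (w \<bullet> w)" for w
  proof (cases "w = 0")
    case False
    have "?q (w /\<^sub>R norm w) \<le> m" unfolding m_def using False by (intro max) simp
    then have "?q w / (norm w)\<^sup>2 \<le> m"
      by (simp add: matrix_vector_mult_scaleR power2_eq_square field_simps)
    then show ?thesis using False by (simp add: divide_le_eq dot_square_norm)
  qed simp
  define g where "g = m *\<^sub>R v - B *v v"
  have "2 * t * (g \<bullet> g) + t\<^sup>2 * (m * (g \<bullet> g) - ?q g) \<ge> 0" for t
  proof -
    have adj: "g \<bullet> (B *v v) = v \<bullet> (B *v g)" using hermitian_adjoint[OF B, of v g] by (simp add: inner_commute)
    have "0 \<le> m * ((v + t *\<^sub>R g) \<bullet> (v + t *\<^sub>R g)) - ?q (v + t *\<^sub>R g)" using le by simp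
    also have "\<dots> = (m * (v \<bullet> v) - ?q v) + 2 * t * (m * (g \<bullet> v) - g \<bullet> (B *v v))
        + t\<^sup>2 * (m * (g \<bullet> g) - ?q g)"
      by (simp add: matrix_vector_right_distrib matrix_vector_mult_scaleR inner_add_left inner_add_right adj
          inner_commute[of v g] power2_eq_square algebra_simps)
    also have "m * (g \<bullet> v) - g \<bullet> (B *v v) = g \<bullet> g"
      by (subst (4) g_def) (simp add: inner_diff_right)
    finally show ?thesis by (simp add: v1 m_def)
  qed
  then have "g \<bullet> g = 0" by (rule linear_term_zero)
  then have "B *v v = m *\<^sub>R v" by (simp add: g_def)
  moreover have "v \<noteq> 0" using nv by auto
  ultimately show ?thesis using le that by blast
qed

lemma hermitian_uminus: "hermitian_matrix A \<Longrightarrow> hermitian_matrix (- A)"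
  by (simp add: hermitian_matrix_def conj_transpose_def vec_eq_iff)

text \<open>The condition on eigenvalues becomes 0 \<le> A \<le> 1 as quadratic forms, by the
  largest eigenvalues of A and of - A.\<close>

lemma psd_contraction_bounds:
  fixes A :: "complex^'n^'n"
  assumes "psd_contraction A"
  shows "0 \<le> w \<bullet> (A *v w)" "w \<bullet> (A *v w) \<le> w \<bullet> w"
proof -
  have A: "hermitian_matrix A" and ev: "\<And>c. eigenvalue_of A c \<Longrightarrow> c \<in> complex_of_real ` {0..1}"
    using assms by (auto simp: psd_contraction_def)
  have ev': "0 \<le> c \<and> c \<le> 1" if "v \<noteq> 0" "A *v v = c *\<^sub>R v" for c v
  proof -
    have "eigenvalue_of A (of_real c)" using that by (auto simp: eigenvalue_of_def of_real_smult_vec)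
    from ev[OF this] show ?thesis by auto
  qed
  obtain m v where l: "v \<noteq> 0" "A *v v = m *\<^sub>R v" "\<And>w. w \<bullet> (A *v w) \<le> m * (w \<bullet> w)"
    using hermitian_max_eigenvalue[OF A] by blast
  have "m * (w \<bullet> w) \<le> 1 * (w \<bullet> w)" using ev'[OF l(1,2)] by (intro mult_right_mono) auto
  with l(3)[of w] show "w \<bullet> (A *v w) \<le> w \<bullet> w" by simp
  have neg: "(- A) *v w = - (A *v w)" for w
    using matrix_vector_mult_diff_rdistrib[of 0 A w] by simp
  obtain \<mu> u where m: "u \<noteq> 0" "(- A) *v u = \<mu> *\<^sub>R u" "\<And>w. w \<bullet> ((- A) *v w) \<le> \<mu> * (w \<bullet> w)"
    using hermitian_max_eigenvalue[OF hermitian_uminus[OF A]] by blast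
  have "A *v u = (- \<mu>) *\<^sub>R u" using m(2) unfolding neg by (metis minus_minus scaleR_minus_left)
  from ev'[OF m(1) this] have "\<mu> * (w \<bullet> w) \<le> 0" by (simp add: mult_nonpos_nonneg)
  with m(3)[of w] show "0 \<le> w \<bullet> (A *v w)" by (simp add: neg)
qed

text \<open>From (c - B) B (c - B) + B (c - B) B = c B (c - B) the right side is positive, hence B^2
  \<le> c B \<le> c^2.\<close>

lemma operator_norm_le_of_bounds:
  fixes B :: "complex^'n^'n"
  assumes B: "hermitian_matrix B" and c: "c > 0"
    and lo: "\<And>w. 0 \<le> w \<bullet> (B *v w)" and up: "\<And>w. w \<bullet> (B *v w) \<le> c * (w \<bullet> w)"
  shows "operator_norm B \<le> c"
  unfolding operator_norm_def
proof (rule onorm_le)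
  fix w
  define y z where "y = B *v w" and "z = B *v y"
  have wz: "w \<bullet> z = y \<bullet> y" using hermitian_adjoint[OF B, of w y] by (simp add: y_def z_def)
  have "0 \<le> (c *\<^sub>R w - y) \<bullet> (B *v (c *\<^sub>R w - y)) + (c * (y \<bullet> y) - y \<bullet> z)"
    using lo[of "c *\<^sub>R w - y"] up[of y] by (simp add: z_def)
  also have "B *v (c *\<^sub>R w - y) = c *\<^sub>R y - z"
    by (simp add: matrix_vector_mult_diff_distrib matrix_vector_mult_scaleR y_def z_def)
  also have "(c *\<^sub>R w - y) \<bullet> (c *\<^sub>R y - z) + (c * (y \<bullet> y) - y \<bullet> z) = c * (c * (w \<bullet> y) - y \<bullet> y)"
    by (simp add: inner_diff_left inner_diff_right wz algebra_simps)
  finally have "y \<bullet> y \<le> c * (w \<bullet> y)" using c by (simp add: zero_le_mult_iff)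
  also have "\<dots> \<le> c * (c * (w \<bullet> w))" using up[of w] c by (simp add: y_def)
  finally have "(norm y)\<^sup>2 \<le> (c * norm w)\<^sup>2" by (simp add: power2_eq_square dot_square_norm[symmetric] power2_norm_eq_inner[symmetric] mult_ac)
  from power2_le_imp_le[OF this] c show "norm (B *v w) \<le> c * norm w" by (simp add: y_def)
qed

text \<open>This is \<open>1 / (b - A) \<le> 1 / b + A / (b (b - 1))\<close>, which holds because \<open>(b - A) A (1 - A)\<close> is positive.\<close>

lemma resolvent_diagonal_bound:
  fixes A :: "complex^'n^'n"
  assumes A: "psd_contraction A" and b: "b > 1" and x: "b *\<^sub>R x - A *v x = axis i 1"
  shows "Re (x $ i) \<le> (b - 1 + Re (A $ i $ i)) / (b * (b - 1))"
proof -
  have H: "hermitian_matrix A" using A by (simp add: psd_contraction_def)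
  note bd = psd_contraction_bounds[OF A]
  define e :: "complex^'n" where "e = axis i 1"
  define y z where "y = A *v x" and "z = A *v y"
  have e: "e = b *\<^sub>R x - y" using x by (simp add: e_def y_def)
  have Ae: "A *v e = b *\<^sub>R y - z"
    by (simp add: e matrix_vector_mult_diff_distrib matrix_vector_mult_scaleR y_def z_def)
  have xz: "x \<bullet> z = y \<bullet> y" using hermitian_adjoint[OF H, of x y] by (simp add: y_def z_def)
  have ee: "e \<bullet> e = 1" by (simp add: e_def inner_axis_axis)
  have ei: "e \<bullet> v = Re (v $ i)" for v :: "complex^'n"
    by (simp add: e_def inner_axis' inner_complex_def)
  have eAe: "e \<bullet> (A *v e) = Re (A $ i $ i)"
    unfolding ei by (simp add: e_def matrix_vector_mult_def axis_def if_distrib cong: if_cong)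
  have "A *v (x - y) = y - z" by (simp add: matrix_vector_mult_diff_distrib y_def z_def)
  with bd(1)[of "x - y"] have "0 \<le> (x - y) \<bullet> (y - z)" by simp
  moreover have "y \<bullet> z \<le> y \<bullet> y" using bd(2)[of y] by (simp add: z_def)
  \<comment> \<open>These are the forms of A (1 - A)^2 and of A (1 - A) = A (1 - A)^2 + A^2 (1 - A)
    at x. They suffice because b - A = (b - 1) + (1 - A).\<close>
  ultimately have p: "0 \<le> x \<bullet> y - 2 * (y \<bullet> y) + y \<bullet> z" "0 \<le> x \<bullet> y - y \<bullet> y"
    by (simp_all add: inner_diff_left inner_diff_right xz)
  have "(b - 1) * (e \<bullet> e) + e \<bullet> (A *v e) - b * (b - 1) * (e \<bullet> x) = e \<bullet> ((b - 1) *\<^sub>R e + A *v e - (b * (b - 1)) *\<^sub>R x)"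
    by (simp add: inner_diff_right inner_add_right)
  also have "(b - 1) *\<^sub>R e + A *v e - (b * (b - 1)) *\<^sub>R x = y - z"
    unfolding Ae by (simp add: e algebra_simps)
  also have "e \<bullet> (y - z) = (b - 1) * (x \<bullet> y - y \<bullet> y) + (x \<bullet> y - 2 * (y \<bullet> y) + y \<bullet> z)"
    by (simp add: e inner_diff_left inner_diff_right xz algebra_simps)
  also have "\<dots> \<ge> 0" using p b by simp
  finally have "b * (b - 1) * (e \<bullet> x) \<le> b - 1 + Re (A $ i $ i)" by (simp add: ee eAe)
  then show ?thesis using b by (simp add: ei le_divide_eq mult.commute)
qed

section \<open>Principal minors\<close>

text \<open>The submatrix on \<open>S\<close> is padded by the identity, so that all principal
  minors are determinants over the one index type 'n and the empty minor is 1.\<close>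

definition minor_matrix :: "complex^'n^'n \<Rightarrow> 'n set \<Rightarrow> ('n \<Rightarrow> complex) \<Rightarrow> complex^'n^'n" where
  "minor_matrix A S w = (\<chi> k l. if k \<in> S \<and> l \<in> S then (if k = l then w k else 0) - A $ k $ l
     else if k = l then 1 else 0)"

definition char_minor :: "complex^'n^'n \<Rightarrow> 'n set \<Rightarrow> ('n \<Rightarrow> complex) \<Rightarrow> complex" where
  "char_minor A S w = det (minor_matrix A S w)"

text \<open>Only permutations fixing \<open>i\<close> contribute, and they never meet the remaining
  entries of column \<open>i\<close>.\<close>

lemma det_eq_of_unit_row:
  fixes M N :: "'a::comm_ring_1^'n^'n"
  assumes "\<And>j. M $ i $ j = (if j = i then 1 else 0)" "\<And>j. N $ i $ j = (if j = i then 1 else 0)"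
    and eq: "\<And>k l. k \<noteq> i \<Longrightarrow> l \<noteq> i \<Longrightarrow> M $ k $ l = N $ k $ l"
  shows "det M = det N"
  unfolding det_def
proof (rule sum.cong[OF refl])
  fix p assume "p \<in> {p. p permutes (UNIV :: 'n set)}"
  then have p: "p permutes UNIV" by simp
  have "(\<Prod>k\<in>UNIV. M $ k $ p k) = (\<Prod>k\<in>UNIV. N $ k $ p k)"
  proof (cases "p i = i")
    case True
    show ?thesis
    proof (rule prod.cong[OF refl])
      fix k
      have "k \<noteq> i \<Longrightarrow> p k \<noteq> i" using True permutes_inj[OF p] by (metis injD)
      then show "M $ k $ p k = N $ k $ p k" using eq assms True by (cases "k = i") auto
    qed
  next
    case False
    then have "(\<Prod>k\<in>UNIV. M $ k $ p k) = 0" "(\<Prod>k\<in>UNIV. N $ k $ p k) = 0"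
      using assms by (auto intro!: prod_zero bexI[of _ i])
    then show ?thesis by simp
  qed
  then show "of_int (sign p) * (\<Prod>k\<in>UNIV. M $ k $ p k) = of_int (sign p) * (\<Prod>k\<in>UNIV. N $ k $ p k)"
    by simp
qed

lemma det_eq_of_unit_column:
  fixes M N :: "'a::comm_ring_1^'n^'n"
  assumes "\<And>k. M $ k $ i = (if k = i then 1 else 0)" "\<And>k. N $ k $ i = (if k = i then 1 else 0)"
    and "\<And>k l. k \<noteq> i \<Longrightarrow> l \<noteq> i \<Longrightarrow> M $ k $ l = N $ k $ l"
  shows "det M = det N"
proof -
  have "det (transpose M) = det (transpose N)"
    by (rule det_eq_of_unit_row[of _ i]) (simp_all add: assms transpose_def)
  then show ?thesis unfolding det_transpose .
qed

lemma char_minor_cong: "(\<And>k. k \<in> S \<Longrightarrow> w k = w' k) \<Longrightarrow> char_minor A S w = char_minor A S w'"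
  unfolding char_minor_def minor_matrix_def by (intro arg_cong[of _ _ det]) (auto simp: vec_eq_iff)

lemma char_minor_empty [simp]: "char_minor A {} w = 1"
proof -
  have "minor_matrix A {} w = mat 1" by (simp add: minor_matrix_def mat_def)
  then show ?thesis by (simp add: char_minor_def)
qed

lemma char_minor_upd:
  assumes "i \<in> S"
  shows "char_minor A S (w(i := x)) = char_minor A S w + (x - w i) * char_minor A (S - {i}) w"
proof -
  let ?M = "minor_matrix A S w"
  have "minor_matrix A S (w(i := x)) = (\<chi> k. if k = i then ?M $ k + (x - w i) *s axis i 1 else ?M $ k)"
    using assms by (auto simp: minor_matrix_def vec_eq_iff axis_def)
  then have "char_minor A S (w(i := x)) = det (\<chi> k. if k = i then ?M $ k else ?M $ k)
      + (x - w i) * det (\<chi> k. if k = i then axis i 1 else ?M $ k)"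
    unfolding char_minor_def by (simp only: det_row_add det_row_mul)
  also have "(\<chi> k. if k = i then ?M $ k else ?M $ k) = ?M" by (simp add: vec_eq_iff)
  also have "det (\<chi> k. if k = i then axis i 1 else ?M $ k) = char_minor A (S - {i}) w"
    unfolding char_minor_def
    by (rule det_eq_of_unit_row[of _ i]) (auto simp: minor_matrix_def axis_def)
  finally show ?thesis unfolding char_minor_def[of A S w] .
qed

lemma char_minor_cnj:
  assumes "hermitian_matrix A"
  shows "char_minor A S (\<lambda>k. cnj (w k)) = cnj (char_minor A S w)"
proof -
  have A: "cnj (A $ i $ j) = A $ j $ i" for i j
    using assms by (auto simp: hermitian_matrix_def conj_transpose_def vec_eq_iff)
  have "cnj (char_minor A S w) = det (\<chi> k l. cnj (minor_matrix A S w $ k $ l))"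
    unfolding char_minor_def det_def by simp
  also have "(\<chi> k l. cnj (minor_matrix A S w $ k $ l)) = transpose (minor_matrix A S (\<lambda>k. cnj (w k)))"
    by (auto simp: vec_eq_iff minor_matrix_def transpose_def A)
  finally show ?thesis by (simp add: char_minor_def)
qed

lemma char_minor_eq_0D:
  fixes A :: "complex^'n^'n"
  assumes "char_minor A S w = 0"
  obtains x :: "complex^'n" where "x \<noteq> 0" "\<And>k. k \<notin> S \<Longrightarrow> x $ k = 0" "\<And>k. k \<in> S \<Longrightarrow> w k * x $ k = (A *v x) $ k"
proof -
  let ?M = "minor_matrix A S w"
  have "\<not> invertible ?M" using assms by (simp add: char_minor_def invertible_det_nz)
  then obtain x where x: "?M *v x = 0" "x \<noteq> 0"
    unfolding invertible_left_inverse matrix_left_invertible_ker by blast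
  have x': "(\<Sum>l\<in>UNIV. ?M $ k $ l * x $ l) = 0" for k
    using x(1) by (auto simp: matrix_vector_mult_def vec_eq_iff)
  have out: "x $ k = 0" if "k \<notin> S" for k
  proof -
    have "(\<Sum>l\<in>UNIV. ?M $ k $ l * x $ l) = (\<Sum>l\<in>UNIV. if k = l then x $ l else 0)"
      using that by (intro sum.cong) (auto simp: minor_matrix_def)
    then show ?thesis using x'[of k] by simp
  qed
  have "w k * x $ k = (A *v x) $ k" if "k \<in> S" for k
  proof -
    have "(\<Sum>l\<in>UNIV. ?M $ k $ l * x $ l) = (\<Sum>l\<in>UNIV. (if k = l then w k * x $ l else 0) - A $ k $ l * x $ l)"
      using that out by (intro sum.cong) (auto simp: minor_matrix_def algebra_simps)
    then show ?thesis using x'[of k] by (simp add: sum_subtractf matrix_vector_mult_def)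
  qed
  with x out that show ?thesis by blast
qed

text \<open>A kernel vector x supported on \<open>S\<close> would make the real number <x, A x>
  equal to the sum of w k |x k|^2, whose imaginary part is positive.\<close>

lemma char_minor_nonzero:
  assumes A: "hermitian_matrix A" and w: "\<And>k. Im (w k) > 0"
  shows "char_minor A S w \<noteq> 0"
proof
  assume "char_minor A S w = 0"
  then obtain x where x: "x \<noteq> 0" "\<And>k. k \<notin> S \<Longrightarrow> x $ k = 0" "\<And>k. k \<in> S \<Longrightarrow> w k * x $ k = (A *v x) $ k"
    using char_minor_eq_0D by blast
  define h where "h = (\<Sum>k\<in>UNIV. cnj (x $ k) * (A *v x) $ k)"
  have "h = (\<Sum>k\<in>UNIV. w k * of_real ((cmod (x $ k))\<^sup>2))"
    unfolding h_def
  proof (rule sum.cong[OF refl])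
    fix k show "cnj (x $ k) * (A *v x) $ k = w k * of_real ((cmod (x $ k))\<^sup>2)"
    proof (cases "k \<in> S")
      case True
      then show ?thesis unfolding x(3)[OF True, symmetric] complex_norm_square by (simp only: mult_ac)
    qed (simp add: x(2))
  qed
  then have "Im h = (\<Sum>k\<in>UNIV. Im (w k) * (cmod (x $ k))\<^sup>2)" by (simp add: Im_sum)
  moreover have "Im h = 0"
  proof -
    \<comment> \<open>The real inner product sees imaginary parts only after one argument is
      multiplied by i. Moving that factor across the symmetric A changes the sign, so Im h = - Im
      h.\<close>
    define x' where "x' = \<i> *s x"
    have Ax': "A *v x' = \<i> *s (A *v x)"
      by (simp add: x'_def vec_eq_iff matrix_vector_mult_def sum_distrib_left mult_ac)
    have "Im h = x' \<bullet> (A *v x)"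
      by (simp add: h_def inner_complex_vec x'_def sum_distrib_left[symmetric] mult.assoc)
    moreover have "Im h = - (x \<bullet> (A *v x'))"
      by (simp add: h_def inner_complex_vec Ax' sum_distrib_left[symmetric] mult.left_commute[of _ \<i>])
    moreover have "x' \<bullet> (A *v x) = x \<bullet> (A *v x')"
      using hermitian_adjoint[OF A, of x' x] by (simp add: inner_commute)
    ultimately show ?thesis by simp
  qed
  moreover obtain k where "x $ k \<noteq> 0" using x(1) by (auto simp: vec_eq_iff)
  then have "0 < (\<Sum>k\<in>UNIV. Im (w k) * (cmod (x $ k))\<^sup>2)"
    using w by (intro sum_pos2[of _ k]) (auto simp: less_imp_le)
  ultimately show False by simp
qed

lemma char_minor_nonzero_above:
  assumes A: "psd_contraction A" and w: "\<And>k. w k > 1"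
  shows "char_minor A S (\<lambda>k. complex_of_real (w k)) \<noteq> 0"
proof
  assume "char_minor A S (\<lambda>k. complex_of_real (w k)) = 0"
  then obtain x where x: "x \<noteq> 0" "\<And>k. k \<notin> S \<Longrightarrow> x $ k = 0"
    "\<And>k. k \<in> S \<Longrightarrow> of_real (w k) * x $ k = (A *v x) $ k"
    using char_minor_eq_0D by blast
  have "x \<bullet> (A *v x) = (\<Sum>k\<in>UNIV. w k * (cmod (x $ k))\<^sup>2)"
    unfolding inner_vec_def
  proof (rule sum.cong[OF refl])
    fix k show "(x $ k) \<bullet> (A *v x) $ k = w k * (cmod (x $ k))\<^sup>2"
    proof (cases "k \<in> S")
      case True
      then show ?thesis unfolding x(3)[OF True, symmetric] cmod_power2 inner_complex_def
        by (simp add: power2_eq_square algebra_simps)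
    qed (simp add: x(2))
  qed
  moreover have "x \<bullet> x = (\<Sum>k\<in>UNIV. (cmod (x $ k))\<^sup>2)"
    by (simp add: inner_vec_def dot_square_norm)
  moreover obtain k where "x $ k \<noteq> 0" using x(1) by (auto simp: vec_eq_iff)
  then have "(\<Sum>k\<in>UNIV. (cmod (x $ k))\<^sup>2) < (\<Sum>k\<in>UNIV. w k * (cmod (x $ k))\<^sup>2)"
  proof (intro sum_strict_mono_ex1)
    show "\<forall>k\<in>UNIV. (cmod (x $ k))\<^sup>2 \<le> w k * (cmod (x $ k))\<^sup>2"
      using w by (simp add: mult_le_cancel_right1 less_imp_le)
    show "\<exists>k\<in>UNIV. (cmod (x $ k))\<^sup>2 < w k * (cmod (x $ k))\<^sup>2"
      using w[of k] \<open>x $ k \<noteq> 0\<close> by (intro bexI[of _ k]) auto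
  qed simp
  ultimately show False using psd_contraction_bounds(2)[OF A, of x] by simp
qed

text \<open>Cramer's rule: x is column \<open>i\<close> of the inverse of b - A, so the logarithmic
  derivative of the determinant in variable \<open>i\<close> is a diagonal entry of the
  resolvent.\<close>

lemma char_minor_resolvent:
  fixes A :: "complex^'n^'n"
  assumes M: "char_minor A UNIV (\<lambda>_. of_real b) \<noteq> 0"
  obtains x :: "complex^'n" where "b *\<^sub>R x - A *v x = axis i 1"
    "char_minor A (UNIV - {i}) (\<lambda>_. of_real b) = x $ i * char_minor A UNIV (\<lambda>_. of_real b)"
proof -
  let ?M = "minor_matrix A UNIV (\<lambda>_. of_real b)"
  have "invertible ?M" using M by (simp add: char_minor_def invertible_det_nz)
  then obtain N where N: "?M ** N = mat 1" by (auto simp: invertible_def)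
  define x where "x = N *v axis i 1"
  have Mx: "?M *v x = axis i 1" by (simp add: x_def matrix_vector_mul_assoc N)
  have "?M *v x = b *\<^sub>R x - A *v x"
  proof (subst vec_eq_iff, intro allI)
    fix k
    have "(\<Sum>l\<in>UNIV. ?M $ k $ l * x $ l) = (\<Sum>l\<in>UNIV. (if k = l then of_real b * x $ l else 0) - A $ k $ l * x $ l)"
      by (intro sum.cong) (auto simp: minor_matrix_def algebra_simps)
    then show "(?M *v x) $ k = (b *\<^sub>R x - A *v x) $ k"
      by (simp add: sum_subtractf matrix_vector_mult_def scaleR_conv_of_real[of b "x $ k"])
  qed
  with Mx have "b *\<^sub>R x - A *v x = axis i 1" by simp
  moreover have "char_minor A (UNIV - {i}) (\<lambda>_. of_real b)
      = det (\<chi> k l. if l = i then (?M *v x) $ k else ?M $ k $ l)"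
    unfolding char_minor_def Mx
    by (rule det_eq_of_unit_column[of _ i]) (simp_all add: minor_matrix_def axis_def)
  then have "char_minor A (UNIV - {i}) (\<lambda>_. of_real b) = x $ i * char_minor A UNIV (\<lambda>_. of_real b)"
    unfolding cramer_lemma char_minor_def .
  ultimately show ?thesis by (rule that)
qed

lemma char_minor_singleton: "char_minor A {i} w = w i - A $ i $ i"
proof -
  have "char_minor A {i} w = (\<Prod>k\<in>UNIV. minor_matrix A {i} w $ k $ k)"
    unfolding char_minor_def by (rule det_diagonal) (auto simp: minor_matrix_def)
  also have "\<dots> = (\<Prod>k\<in>UNIV. if k = i then w i - A $ i $ i else 1)"
    by (intro prod.cong) (auto simp: minor_matrix_def)
  finally show ?thesis by simp
qed

text \<open>The starting point \<open>b\<close> minimises the final bound \<open>b - \<delta>\<close>.\<close>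

lemma paving_parameters:
  fixes r \<alpha> :: real
  assumes r: "r \<ge> 2" and \<alpha>: "0 < \<alpha>" "\<alpha> < (r - 1)\<^sup>2 / r\<^sup>2"
  defines "p \<equiv> sqrt (1 / r - \<alpha> / (r - 1))" and "s \<equiv> sqrt \<alpha>"
  defines "b \<equiv> r * p * (p + s)"
  defines "\<phi> \<equiv> r * ((b - 1 + \<alpha>) / (b * (b - 1)))"
  shows "b > 1" "1 / b < \<phi>" "b - (r - 1)\<^sup>2 / (r * (\<phi> - 1 / b)) = (p + s)\<^sup>2" "p + s > 0"
proof -
  have ar: "\<alpha> * r\<^sup>2 < (r - 1)\<^sup>2" using \<alpha>(2) r by (simp add: less_divide_eq)
  have s: "s > 0" "s\<^sup>2 = \<alpha>" using \<alpha> by (auto simp: s_def)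
  have key: "(r - 1)\<^sup>2 * (1 / r - \<alpha> / (r - 1)) > \<alpha>"
  proof -
    have "(r - 1)\<^sup>2 * (1 / r - \<alpha> / (r - 1)) - \<alpha> = ((r - 1)\<^sup>2 - \<alpha> * r\<^sup>2) / r"
      using r by (simp add: power2_eq_square field_simps)
    also have "\<dots> > 0" using ar r by simp
    finally show ?thesis by simp
  qed
  have "1 / r - \<alpha> / (r - 1) > 0"
  proof (rule ccontr)
    assume "\<not> ?thesis"
    then have "(r - 1)\<^sup>2 * (1 / r - \<alpha> / (r - 1)) \<le> 0" by (intro mult_nonneg_nonpos) auto
    with key \<alpha>(1) show False by simp
  qed
  then have p: "p > 0" "p\<^sup>2 = 1 / r - \<alpha> / (r - 1)" by (auto simp: p_def)
  \<comment> \<open>q > 0 expresses the strict bound on \<alpha>. It factors everything: b - 1 = r s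
    q / (r - 1) and the shift is (p + s) q, so that b minus the shift is (p + s)(r p - q) = (p +
    s)^2.\<close>
  define q where "q = (r - 1) * p - s"
  have "s\<^sup>2 < ((r - 1) * p)\<^sup>2" using key by (simp add: power_mult_distrib p s)
  then have "s < (r - 1) * p" by (rule power_less_imp_less_base) (use r p in simp)
  then have q: "q > 0" by (simp add: q_def)
  have rel: "r * p\<^sup>2 + r * s\<^sup>2 / (r - 1) = 1" using r by (simp add: p s right_diff_distrib)
  have "b - 1 = r * p * s - r * s\<^sup>2 / (r - 1)"
    using rel by (simp add: b_def algebra_simps power2_eq_square)
  also have "\<dots> = r * s * q / (r - 1)"
    using r by (simp add: q_def power2_eq_square diff_divide_distrib right_diff_distrib)
  finally have b1: "b - 1 = r * s * q / (r - 1)" .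
  also have "\<dots> > 0" using r s q by simp
  finally show b: "b > 1" by simp
  have rs: "r * s > 0" using r s by simp
  have "\<phi> - 1 / b = (r * (b - 1 + s\<^sup>2) - (b - 1)) / (b * (b - 1))"
    using b by (simp add: \<phi>_def s(2) field_simps)
  also have "r * (b - 1 + s\<^sup>2) - (b - 1) = (r - 1) * (b - 1) + r * s\<^sup>2" by (simp add: algebra_simps)
  also have "(r - 1) * (b - 1) = r * s * q" using r unfolding b1 by simp
  also have "r * s * q + r * s\<^sup>2 = r * s * ((r - 1) * p)" by (simp add: q_def power2_eq_square algebra_simps)
  also have "b * (b - 1) = r * p * (p + s) * (r * s * q / (r - 1))" unfolding b1 by (simp add: b_def)
  also have "r * s * ((r - 1) * p) / \<dots> = (r - 1)\<^sup>2 / (r * ((p + s) * q))"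
  proof -
    have "r \<noteq> 0" "r - 1 \<noteq> 0" "p \<noteq> 0" "s \<noteq> 0" "q \<noteq> 0" "p + s \<noteq> 0" using r p s q by auto
    then show ?thesis by (simp add: power2_eq_square divide_simps)
  qed
  finally have \<phi>: "\<phi> - 1 / b = (r - 1)\<^sup>2 / (r * ((p + s) * q))" .
  have "(r - 1)\<^sup>2 / (r * ((p + s) * q)) > 0" using r p s q by simp
  then show "1 / b < \<phi>" using \<phi> by simp
  have "(r - 1)\<^sup>2 / (r * (\<phi> - 1 / b)) = (p + s) * q"
    unfolding \<phi> using r p s q by (simp add: field_simps)
  then show "b - (r - 1)\<^sup>2 / (r * (\<phi> - 1 / b)) = (p + s)\<^sup>2"
    by (simp add: b_def q_def power2_eq_square algebra_simps)
  show "p + s > 0" using p s by simp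
qed

section \<open>The stable family of a Hermitian matrix\<close>

definition minor_family ::
    "complex^'n^'n \<Rightarrow> ('n \<times> nat) set \<Rightarrow> ('n \<times> nat \<Rightarrow> complex) \<Rightarrow> complex" where
  "minor_family A T z = (\<Prod>j\<in>snd ` T. char_minor A {i. (i, j) \<in> T} (\<lambda>i. z (i, j)))"

text \<open>Columns not met by \<open>T\<close> contribute the empty minor 1, so \<open>T\<close>
  and \<open>T - {v}\<close> can be compared over a common index set.\<close>

lemma minor_family_eq:
  assumes "finite J" "snd ` T \<subseteq> J"
  shows "minor_family A T z = (\<Prod>j\<in>J. char_minor A {i. (i, j) \<in> T} (\<lambda>i. z (i, j)))"
  unfolding minor_family_def
proof (rule prod.mono_neutral_left[OF assms], intro ballI)
  fix j assume "j \<in> J - snd ` T"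
  then have "{i. (i, j) \<in> T} = {}" by force
  then show "char_minor A {i. (i, j) \<in> T} (\<lambda>i. z (i, j)) = 1" by simp
qed

lemma minor_family_column: "minor_family A (S \<times> {j}) z = char_minor A S (\<lambda>i. z (i, j))"
  using minor_family_eq[of "{j}" "S \<times> {j}" A z] by (simp add: image_subset_iff)

lemma stable_family_minor_family:
  fixes A :: "complex^'n^'n"
  assumes A: "hermitian_matrix A"
  shows "stable_family (minor_family A)"
proof
  fix T :: "('n \<times> nat) set" and z z' :: "'n \<times> nat \<Rightarrow> complex" and v w
  show "minor_family A {} z = 1" by (simp add: minor_family_def)
  show "minor_family A T z = minor_family A T z'" if "finite T" "\<And>v. v \<in> T \<Longrightarrow> z v = z' v"
    unfolding minor_family_def using that by (intro prod.cong refl char_minor_cong) auto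
  show "minor_family A T (\<lambda>v. cnj (z v)) = cnj (minor_family A T z)"
    by (simp add: minor_family_def char_minor_cnj[OF A] cnj_prod)
  show "minor_family A T z \<noteq> 0" if "finite T" "\<And>v. Im (z v) > 0"
    unfolding minor_family_def using that by (simp add: char_minor_nonzero[OF A])
  show "minor_family A T (z(v := w)) = minor_family A T z + (w - z v) * minor_family A (T - {v}) z"
    if T: "finite T" "v \<in> T"
  proof -
    obtain i j where v: "v = (i, j)" by (cases v)
    define J where "J = snd ` T"
    have J: "finite J" "snd ` T \<subseteq> J" "snd ` (T - {v}) \<subseteq> J" "j \<in> J" using T v by (auto simp: J_def image_iff intro: bexI[of _ v])
    define F where "F z T j = char_minor A {i. (i, j) \<in> T} (\<lambda>i. z (i, j))" for z :: "'n \<times> nat \<Rightarrow> complex" and T j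
    have split: "minor_family A S y = F y S j * (\<Prod>k\<in>J - {j}. F y S k)" if "snd ` S \<subseteq> J" for S y
      unfolding minor_family_eq[OF J(1) that] F_def by (rule prod.remove[OF J(1) J(4)])
    have other: "F (z(v := w)) T k = F z T k" "F z (T - {v}) k = F z T k" if "k \<noteq> j" for k
    proof -
      show "F (z(v := w)) T k = F z T k" unfolding F_def using that v by (intro char_minor_cong) auto
      have "{i. (i, k) \<in> T - {v}} = {i. (i, k) \<in> T}" using that v by auto
      then show "F z (T - {v}) k = F z T k" by (simp add: F_def)
    qed
    have main: "F (z(v := w)) T j = F z T j + (w - z v) * F z (T - {v}) j"
    proof -
      have 1: "(\<lambda>i'. (z(v := w)) (i', j)) = (\<lambda>i'. z (i', j))(i := w)" by (auto simp: v fun_eq_iff)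
      have 2: "{i'. (i', j) \<in> T - {v}} = {i'. (i', j) \<in> T} - {i}" by (auto simp: v)
      have 3: "i \<in> {i'. (i', j) \<in> T}" using T v by simp
      show ?thesis unfolding F_def 1 2 char_minor_upd[OF 3] by (simp add: v)
    qed
    have "(\<Prod>k\<in>J - {j}. F (z(v := w)) T k) = (\<Prod>k\<in>J - {j}. F z T k)"
      "(\<Prod>k\<in>J - {j}. F z (T - {v}) k) = (\<Prod>k\<in>J - {j}. F z T k)"
      by (intro prod.cong refl; simp add: other)+
    then show ?thesis
      unfolding split[OF J(2)] split[OF J(3)] main by (simp only: algebra_simps)
  qed
qed

lemma hermitian_diagonal: "hermitian_matrix A \<Longrightarrow> A $ i $ i = of_real (Re (A $ i $ i))"
  by (auto simp: hermitian_matrix_def conj_transpose_def vec_eq_iff complex_eq_iff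
      dest!: spec[of _ i] arg_cong[of _ _ Im])

lemma psd_contraction_diagonal_nonneg: "psd_contraction A \<Longrightarrow> 0 \<le> Re (A $ i $ i)"
proof -
  assume "psd_contraction A"
  from psd_contraction_bounds(1)[OF this, of "axis i 1"] have "0 \<le> Re ((A *v axis i 1) $ i)"
    by (simp add: inner_axis' inner_complex_def)
  then show ?thesis by (simp add: matrix_vector_mult_def axis_def if_distrib cong: if_cong)
qed

lemma sorted_wrt_disjnt_blocks:
  "distinct xs \<Longrightarrow> sorted_wrt disjnt (map (\<lambda>i. {i} \<times> J) xs)"
  by (induction xs) (auto simp: disjnt_def)

text \<open>\<open>C\<close> assigns to the index \<open>i\<close> the one part \<open>j\<close>
  with \<open>(i, j) \<in> C\<close>, so the columns of \<open>C\<close> are the parts. Nonvanishing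
  from \<open>c\<close> on bounds the largest eigenvalue of each compression.\<close>

lemma ex_transversal:
  fixes A :: "complex^'n^'n" and r :: nat
  assumes r: "r \<ge> 2" and \<alpha>: "0 < \<alpha>" "\<alpha> < (real r - 1)\<^sup>2 / (real r)\<^sup>2"
    and A: "psd_contraction A" and diag: "\<And>i. Re (A $ i $ i) \<le> \<alpha>"
  defines "c \<equiv> (sqrt (1 / real r - \<alpha> / (real r - 1)) + sqrt \<alpha>)\<^sup>2"
  shows "\<exists>C \<subseteq> UNIV \<times> {1..r}. (\<forall>i. \<exists>v. ({i} \<times> {1..r}) \<inter> C = {v}) \<and>
    (\<forall>j. \<forall>x\<ge>c. char_minor A {i. (i, j) \<in> C} (\<lambda>_. of_real x) \<noteq> 0)"
proof -
  have H: "hermitian_matrix A" using A by (simp add: psd_contraction_def)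
  interpret stable_family "minor_family A" by (rule stable_family_minor_family[OF H])
  define b where "b = real r * sqrt (1 / real r - \<alpha> / (real r - 1))
    * (sqrt (1 / real r - \<alpha> / (real r - 1)) + sqrt \<alpha>)"
  define \<phi> where "\<phi> = real r * ((b - 1 + \<alpha>) / (b * (b - 1)))"
  have par: "b > 1" "1 / b < \<phi>" "b - (real r - 1)\<^sup>2 / (real r * (\<phi> - 1 / b)) = c"
    unfolding \<phi>_def b_def c_def using paving_parameters(1-3)[of "real r" \<alpha>] r \<alpha> by simp_all
  obtain xs :: "'n list" where xs: "set xs = UNIV" "distinct xs" using finite_distinct_list[OF finite[of "UNIV :: 'n set"]] by blast
  define cs where "cs = map (\<lambda>i. {i} \<times> {1..r}) xs"
  define T where "T = (UNIV :: 'n set) \<times> {1..r}"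
  have T: "\<Union>(set cs) = T" "finite T" by (auto simp: cs_def T_def xs)
  define y where "y = (\<lambda>_ :: 'n \<times> nat. b)"
  have fam: "minor_family A S z = (\<Prod>j\<in>{1..r}. char_minor A {i. (i, j) \<in> S} (\<lambda>i. z (i, j)))"
    if "S \<subseteq> T" for S z
    by (rule minor_family_eq) (use that in \<open>auto simp: T_def\<close>)
  have slice: "{i. (i, j) \<in> T} = UNIV" if "j \<in> {1..r}" for j using that by (auto simp: T_def)
  have pos0: "positive_above [] T y"
  proof (rule positive_above_of_nonzero)
    fix x assume "y \<le> x"
    then have x: "x v > 1" for v
      using par(1) le_funD[of y x v] by (simp add: y_def)
    have "minor_family A T (\<lambda>v. of_real (x v)) \<noteq> 0"
      unfolding fam[OF order_refl] using char_minor_nonzero_above[OF A] x by simp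
    then show "er [] T x \<noteq> 0" using E_real[of "[]" T x] T(2) by auto
  qed (use T in simp)
  have bar: "barrier [] T y ({i} \<times> {1..r}) \<le> \<phi>" for i
  proof -
    let ?w = "\<lambda>_ :: 'n. complex_of_real b"
    have "char_minor A UNIV ?w \<noteq> 0" using char_minor_nonzero_above[OF A, of "\<lambda>_. b"] par(1) by simp
    then obtain x where x: "b *\<^sub>R x - A *v x = axis i 1"
      "char_minor A (UNIV - {i}) ?w = x $ i * char_minor A UNIV ?w"
      using char_minor_resolvent by blast
    \<comment> \<open>Deleting (i, j) alters only the factor of column j, by the diagonal entry x $
      i of the resolvent. It is the same for all r columns, whence the factor r in \<phi>.\<close>
    have "er [] (T - {(i, j)}) y = Re (x $ i) * er [] T y" if j: "j \<in> {1..r}" for j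
    proof -
      let ?F = "\<lambda>S k. char_minor A {i'. (i', k) \<in> S} ?w"
      have "minor_family A (T - {(i, j)}) (\<lambda>_. of_real b) = (\<Prod>k\<in>{1..r}. ?F (T - {(i, j)}) k)"
        by (rule fam) auto
      also have "\<dots> = ?F (T - {(i, j)}) j * (\<Prod>k\<in>{1..r} - {j}. ?F (T - {(i, j)}) k)"
        by (rule prod.remove) (use j in auto)
      also have "{i'. (i', j) \<in> T - {(i, j)}} = UNIV - {i}" using slice[OF j] by auto
      also have "(\<Prod>k\<in>{1..r} - {j}. ?F (T - {(i, j)}) k) = (\<Prod>k\<in>{1..r} - {j}. ?F T k)"
        by (intro prod.cong refl arg_cong2[of _ _ _ _ "char_minor A"]) auto
      also have "char_minor A (UNIV - {i}) ?w * \<dots> = x $ i * (?F T j * \<dots>)"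
        unfolding x(2) slice[OF j] by (simp only: mult.assoc)
      also have "?F T j * (\<Prod>k\<in>{1..r} - {j}. ?F T k) = (\<Prod>k\<in>{1..r}. ?F T k)"
        by (rule prod.remove[symmetric]) (use j in auto)
      also have "\<dots> = minor_family A T (\<lambda>_. of_real b)" by (rule fam[symmetric]) simp
      also have "\<dots> = of_real (er [] T y)" using E_real[of "[]" T y] T(2) by (simp add: y_def)
      finally have "E [] (T - {(i, j)}) (\<lambda>v. of_real (y v)) = x $ i * of_real (er [] T y)"
        by (simp add: y_def)
      then show ?thesis by (simp add: er_def)
    qed
    then have "(\<Sum>v\<in>{i} \<times> {1..r}. er [] (T - {v}) y) = (\<Sum>v\<in>{i} \<times> {1..r}. Re (x $ i) * er [] T y)"
      by (intro sum.cong refl) auto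
    then have "barrier [] T y ({i} \<times> {1..r}) = real r * Re (x $ i)"
      using positive_aboveD[OF pos0 order_refl] by (simp add: barrier_def card_cartesian_product)
    also have "\<dots> \<le> \<phi>" unfolding \<phi>_def
    proof (rule mult_left_mono)
      have "Re (x $ i) \<le> (b - 1 + Re (A $ i $ i)) / (b * (b - 1))"
        by (rule resolvent_diagonal_bound[OF A par(1) x(1)])
      also have "\<dots> \<le> (b - 1 + \<alpha>) / (b * (b - 1))"
        using par(1) diag[of i] by (intro divide_right_mono) auto
      finally show "Re (x $ i) \<le> (b - 1 + \<alpha>) / (b * (b - 1))" .
    qed simp
    finally show ?thesis .
  qed
  \<comment> \<open>Inside the block of one index each column holds at most one variable, so only 1
    by 1 minors occur.\<close>
  have er_block: "er [] S x = (\<Prod>v\<in>S. x v - Re (A $ fst v $ fst v))" if S: "S \<subseteq> {i} \<times> {1..r}" for S x i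
  proof -
    have inj: "inj_on snd S" using S by (auto simp: inj_on_def)
    have "minor_family A S (\<lambda>v. of_real (x v)) = (\<Prod>v\<in>S. char_minor A {i'. (i', snd v) \<in> S} (\<lambda>i'. of_real (x (i', snd v))))"
      unfolding minor_family_def by (simp add: prod.reindex[OF inj])
    also have "\<dots> = (\<Prod>v\<in>S. complex_of_real (x v - Re (A $ fst v $ fst v)))"
    proof (rule prod.cong[OF refl])
      fix v assume v: "v \<in> S"
      then have "{i'. (i', snd v) \<in> S} = {i}" "v = (i, snd v)" using S by auto
      then show "char_minor A {i'. (i', snd v) \<in> S} (\<lambda>i'. of_real (x (i', snd v)))
          = of_real (x v - Re (A $ fst v $ fst v))"
        using hermitian_diagonal[OF H, of i] by (metis char_minor_singleton fst_conv of_real_diff)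
    qed
    finally have "minor_family A S (\<lambda>v. of_real (x v)) = of_real (\<Prod>v\<in>S. x v - Re (A $ fst v $ fst v))"
      unfolding of_real_prod .
    then show ?thesis unfolding er_def E_Nil by (simp only: Re_complex_of_real)
  qed
  have final: "positive_above (rev cs @ []) {} (\<lambda>v. if v \<in> \<Union>(set cs) then y v - (real r - 1)\<^sup>2 / (real r * (\<phi> - 1 / b)) else y v)"
  proof (rule barrier_iterate)
    show "sorted_wrt disjnt cs" unfolding cs_def by (rule sorted_wrt_disjnt_blocks[OF xs(2)])
    show "positive_above [] (\<Union>(set cs)) y" unfolding T by (rule pos0)
    show "card C = r" if "C \<in> set cs" for C using that by (auto simp: cs_def card_cartesian_product)
    show "barrier [] (\<Union>(set cs)) y C \<le> \<phi>" if "C \<in> set cs" for C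
      using that bar unfolding T by (auto simp: cs_def)
    show "er [] S x = (\<Prod>v\<in>S. x v - Re (A $ fst v $ fst v))" if "C \<in> set cs" "S \<subseteq> C" for C S x
      using that er_block by (auto simp: cs_def)
    show "0 \<le> Re (A $ fst v $ fst v)" for v :: "'n \<times> nat" by (rule psd_contraction_diagonal_nonneg[OF A])
  qed (use par r T in \<open>auto simp: y_def\<close>)
  define y' where "y' = (\<lambda>v. if v \<in> T then c else b)"
  have pos1: "positive_above (rev cs) {} y'" using final unfolding T par(3)[symmetric] y'_def y_def by simp
  have admissible: "admissible (rev cs) {}"
  proof -
    have "sorted_wrt disjnt (rev cs)"
      using sorted_wrt_disjnt_blocks[OF xs(2), of "{1..r}"] unfolding cs_def sorted_wrt_rev
      by (rule sorted_wrt_mono_rel[rotated]) (simp add: disjnt_sym)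
    then show ?thesis using r by (auto simp: admissible_def cs_def)
  qed
  from positive_above_transversal[OF admissible pos1] obtain C where C: "C \<subseteq> \<Union>(set (rev cs))" "\<forall>B\<in>set (rev cs). \<exists>v. B \<inter> C = {v}" "positive_above [] ({} \<union> C) y'"
    by (elim exE conjE)
  have CT: "C \<subseteq> T" using C(1) T by simp
  have finC: "finite C" using CT T(2) finite_subset by blast
  show ?thesis
  proof (intro exI[of _ C] conjI allI impI)
    show "C \<subseteq> UNIV \<times> {1..r}" using CT by (simp add: T_def)
    show "\<exists>v. {i} \<times> {1..r} \<inter> C = {v}" for i using C(2) by (simp add: cs_def xs)
    fix j x assume x: "c \<le> x"
    let ?S = "{i. (i, j) \<in> C}"
    have sub: "?S \<times> {j} \<subseteq> C" by auto
    \<comment> \<open>Passing from \<open>C\<close> to one of its columns is a removal of variables,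
      so it keeps the point above the roots and isolates a single factor of the product.\<close>
    have "er [] (?S \<times> {j}) (\<lambda>_. x) > 0"
    proof (rule positive_above_cong)
      show "admissible [] (?S \<times> {j})" using finite_subset[OF sub finC] by simp
      show "positive_above [] (?S \<times> {j}) y'" by (rule positive_above_subset[OF _ sub]) (use C(3) finC in auto)
      show "y' v \<le> x" if "v \<in> ?S \<times> {j} \<union> \<Union>(set [])" for v
        using that x CT by (auto simp: y'_def)
    qed
    then show "char_minor A ?S (\<lambda>_. of_real x) \<noteq> 0"
      by (auto simp: er_def minor_family_column)
  qed
qed

section \<open>Compressions to coordinate subspaces and the final partition\<close>

definition coordinate_projection :: "'n set \<Rightarrow> complex^'n^'n" where
  "coordinate_projection S = (\<chi> k l. if k = l \<and> k \<in> S then 1 else 0)"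

lemma coordinate_projection_mult: "coordinate_projection S *v w = (\<chi> k. if k \<in> S then w $ k else 0)"
proof -
  have "(\<Sum>l\<in>UNIV. (if k = l \<and> k \<in> S then 1 else 0) * w $ l) = (\<Sum>l\<in>UNIV. if k = l then (if k \<in> S then w $ l else 0) else 0)" for k
    by (intro sum.cong) auto
  then show ?thesis by (simp add: coordinate_projection_def matrix_vector_mult_def vec_eq_iff)
qed

lemma diagonal_projection_coordinate: "diagonal_projection (coordinate_projection S)"
proof -
  have "coordinate_projection S ** coordinate_projection S = coordinate_projection S"
    by (rule matrix_eq[THEN iffD2]) (simp add: matrix_vector_mul_assoc[symmetric] coordinate_projection_mult vec_eq_iff)
  then show ?thesis
    by (auto simp: diagonal_projection_def coordinate_projection_def conj_transpose_def vec_eq_iff)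
qed

text \<open>An eigenvector for a largest eigenvalue m > c > 0 vanishes outside \<open>S\<close>,
  because there the compression gives 0 = m v k. It then lies in the kernel of the minor matrix at
  m, whose determinant is nonzero.\<close>

lemma operator_norm_compression:
  fixes A :: "complex^'n^'n"
  assumes A: "psd_contraction A" and c: "c > 0"
    and nz: "\<And>x. x \<ge> c \<Longrightarrow> char_minor A S (\<lambda>_. of_real x) \<noteq> 0"
  shows "operator_norm (coordinate_projection S ** A ** coordinate_projection S) \<le> c"
proof -
  let ?Q = "coordinate_projection S"
  let ?B = "?Q ** A ** ?Q"
  have H: "hermitian_matrix A" using A by (simp add: psd_contraction_def)
  have Bv: "?B *v w = ?Q *v (A *v (?Q *v w))" for w by (simp add: matrix_vector_mul_assoc matrix_mul_assoc)
  have B: "?B $ k $ l = (if k \<in> S \<and> l \<in> S then A $ k $ l else 0)" for k l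
  proof -
    have "?B $ k $ l = (?B *v axis l 1) $ k" by (simp add: matrix_vector_mult_def axis_def if_distrib cong: if_cong)
    also have "\<dots> = (if k \<in> S then (\<Sum>j\<in>UNIV. A $ k $ j * (if j \<in> S then axis l 1 $ j else 0)) else 0)"
      unfolding Bv coordinate_projection_mult by (simp add: matrix_vector_mult_def)
    also have "(\<Sum>j\<in>UNIV. A $ k $ j * (if j \<in> S then axis l 1 $ j else 0))
        = (\<Sum>j\<in>UNIV. if j = l then (if l \<in> S then A $ k $ l else 0) else 0)"
      by (intro sum.cong) (auto simp: axis_def)
    finally show ?thesis by simp
  qed
  have HB: "hermitian_matrix ?B"
    using H by (auto simp: hermitian_matrix_def conj_transpose_def vec_eq_iff B)
  have HQ: "hermitian_matrix ?Q"
    by (auto simp: hermitian_matrix_def conj_transpose_def vec_eq_iff coordinate_projection_def)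
  have lo: "0 \<le> w \<bullet> (?B *v w)" for w
    unfolding Bv hermitian_adjoint[OF HQ, symmetric] by (rule psd_contraction_bounds(1)[OF A])
  obtain m v where m: "v \<noteq> 0" "?B *v v = m *\<^sub>R v" "\<And>w. w \<bullet> (?B *v w) \<le> m * (w \<bullet> w)"
    using hermitian_max_eigenvalue[OF HB] by blast
  have "m \<le> c"
  proof (rule ccontr)
    assume mc: "\<not> m \<le> c"
    have vk: "(\<Sum>l\<in>UNIV. ?B $ k $ l * v $ l) = of_real m * v $ k" for k
      using arg_cong[OF m(2), of "\<lambda>u. u $ k"] by (simp add: matrix_vector_mult_def scaleR_conv_of_real[of m "v $ k"])
    have out: "v $ k = 0" if "k \<notin> S" for k using vk[of k] that mc c by (simp add: B)
    have "minor_matrix A S (\<lambda>_. of_real m) *v v = 0"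
    proof (subst vec_eq_iff, intro allI)
      fix k
      have "(minor_matrix A S (\<lambda>_. of_real m) *v v) $ k
        = (\<Sum>l\<in>UNIV. (if k = l then (if k \<in> S then of_real m * v $ l else v $ l) else 0) - ?B $ k $ l * v $ l)"
        unfolding matrix_vector_mult_def
        by (simp, intro sum.cong) (auto simp: minor_matrix_def B algebra_simps)
      also have "\<dots> = 0" using out[of k] vk[of k] by (simp add: sum_subtractf)
      finally show "(minor_matrix A S (\<lambda>_. of_real m) *v v) $ k = 0 $ k" by simp
    qed
    moreover have "invertible (minor_matrix A S (\<lambda>_. of_real m))"
      using nz[of m] mc by (simp add: invertible_det_nz char_minor_def)
    ultimately show False using m(1)
      unfolding invertible_left_inverse matrix_left_invertible_ker by blast
  qed
  show ?thesis
  proof (rule operator_norm_le_of_bounds[OF HB c lo])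
    fix w show "w \<bullet> (?B *v w) \<le> c * (w \<bullet> w)"
      using m(3)[of w] mult_right_mono[OF \<open>m \<le> c\<close>, of "w \<bullet> w"] by simp
  qed
qed

theorem theorem1p4:
  fixes r :: nat and \<alpha> :: real and A :: "complex^'n^'n"
  assumes "r \<ge> 2"
    and "0 < \<alpha>" and "\<alpha> \<le> (real r - 1)\<^sup>2 / (real r)\<^sup>2"
    and "psd_contraction A"
    and "\<And>i. Re (A $ i $ i) \<le> \<alpha>"
  shows "\<exists>Q :: nat \<Rightarrow> complex^'n^'n.
           (\<forall>i\<in>{1..r}. diagonal_projection (Q i)) \<and>
           (\<Sum>i=1..r. Q i) = mat 1 \<and>
           (\<forall>i\<in>{1..r}. operator_norm (Q i ** A ** Q i)
              \<le> (sqrt (1 / real r - \<alpha> / (real r - 1)) + sqrt \<alpha>)\<^sup>2)"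
proof (cases "\<alpha> = (real r - 1)\<^sup>2 / (real r)\<^sup>2")
  case True
  \<comment> \<open>The endpoint where the optimal \<open>b\<close> would be 1: the two square roots
    are 1 / r and (r - 1) / r, the bound is 1, and Q 1 = I with all other Q i = 0 meets it.\<close>
  have "1 / real r - \<alpha> / (real r - 1) = (1 / real r)\<^sup>2" "\<alpha> = ((real r - 1) / real r)\<^sup>2"
    using assms(1) by (auto simp: True power2_eq_square field_simps)
  then have sq: "sqrt (1 / real r - \<alpha> / (real r - 1)) = 1 / real r" "sqrt \<alpha> = (real r - 1) / real r"
    using assms(1) by auto
  have bound: "(sqrt (1 / real r - \<alpha> / (real r - 1)) + sqrt \<alpha>)\<^sup>2 = 1"
    unfolding sq using assms(1) by (simp flip: add_divide_distrib)
  define Q where "Q = (\<lambda>i. coordinate_projection (if i = (1::nat) then UNIV else {}) :: complex^'n^'n)"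
  have Q1: "Q 1 = mat 1" and Q0: "i \<noteq> 1 \<Longrightarrow> Q i = 0" for i
    by (auto simp: Q_def coordinate_projection_def mat_def vec_eq_iff)
  show ?thesis unfolding bound
  proof (intro exI[of _ Q] conjI ballI)
    show "diagonal_projection (Q i)" for i unfolding Q_def by (rule diagonal_projection_coordinate)
    have "(\<Sum>i=1..r. Q i) = (\<Sum>i\<in>{1}. Q i)"
      using assms(1) by (intro sum.mono_neutral_right) (auto simp: Q0)
    then show "(\<Sum>i=1..r. Q i) = mat 1" using Q1 by simp
    have "operator_norm A \<le> 1"
      using psd_contraction_bounds[OF assms(4)] assms(4)
      by (intro operator_norm_le_of_bounds) (auto simp: psd_contraction_def)
    then show "operator_norm (Q i ** A ** Q i) \<le> 1" for i
      using Q1 operator_norm_compression[OF assms(4), of 1 "{}"] by (cases "i = 1") (simp_all add: Q_def)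
  qed
next
  case False
  then have \<alpha>: "\<alpha> < (real r - 1)\<^sup>2 / (real r)\<^sup>2" using assms(3) by simp
  let ?c = "(sqrt (1 / real r - \<alpha> / (real r - 1)) + sqrt \<alpha>)\<^sup>2"
  have c: "?c > 0" using paving_parameters(4)[of "real r" \<alpha>] assms(1,2) \<alpha> by simp
  obtain C where C: "C \<subseteq> UNIV \<times> {1..r}" "\<And>i. \<exists>v. ({i} \<times> {1..r}) \<inter> C = {v}"
    "\<And>j x. x \<ge> ?c \<Longrightarrow> char_minor A {i. (i, j) \<in> C} (\<lambda>_. of_real x) \<noteq> 0"
    using ex_transversal[OF assms(1,2) \<alpha> assms(4,5)] by blast
  define Q where "Q = (\<lambda>j. coordinate_projection {i. (i, j) \<in> C})"
  have entry: "(\<Sum>j=1..r. if (k, j) \<in> C then 1 else 0) = (1 :: complex)" for k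
  proof -
    obtain v where v: "({k} \<times> {1..r}) \<inter> C = {v}" using C(2) by blast
    then have "v \<in> {k} \<times> {1..r}" by blast
    then obtain j where j: "v = (k, j)" "j \<in> {1..r}" by auto
    have "(k, i) \<in> C \<longleftrightarrow> i = j" if "i \<in> {1..r}" for i
    proof -
      have "(k, i) \<in> C \<longleftrightarrow> (k, i) \<in> ({k} \<times> {1..r}) \<inter> C" using that by blast
      also have "\<dots> \<longleftrightarrow> i = j" unfolding v by (simp add: j(1))
      finally show ?thesis .
    qed
    then have "(\<Sum>j=1..r. if (k, j) \<in> C then 1 else 0) = (\<Sum>i=1..r. if i = j then 1 else 0 :: complex)"
      by (intro sum.cong) auto
    then show ?thesis using j(2) by simp
  qed
  have "(\<Sum>j=1..r. Q j) = mat 1"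
  proof -
    have "(\<Sum>j=1..r. if k = l \<and> (k, j) \<in> C then 1 else 0) = (if k = l then 1 else 0 :: complex)" for k l
      using entry[of k] by (cases "k = l") auto
    then show ?thesis by (simp add: vec_eq_iff Q_def coordinate_projection_def mat_def)
  qed
  moreover have "operator_norm (Q j ** A ** Q j) \<le> ?c" for j
    unfolding Q_def by (rule operator_norm_compression[OF assms(4) c C(3)])
  ultimately show ?thesis
    by (intro exI[of _ Q]) (auto simp: Q_def diagonal_projection_coordinate)
qed

end
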